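(* Let $\beta>0$. For both the relativistic black-hole model, $x(y)=-e^{-y}$, and the CGHS black-hole model, $x(y)=-\log(1+e^{-y})$, $$\lim_{y\to+\infty}\widehat T^{Th}_{\beta,in}(y)=T^{Th}_{2\pi,out};$$ furthermore, for the CGHS model, $$\lim_{y\to-\infty}\widehat T^{Th}_{\beta,in}(y)=T^{Th}_{\beta,out},$$ where $T^{Th}_{\beta,out}=\frac{\pi}{12\beta^2}$ (so $T^{Th}_{2\pi,out}=\frac1{48\pi}$). This holds for the real and for the complex massless scalar field.
   Context: Massless right-moving field: $\phi(x)=\frac1{\sqrt{2\pi}}\int_0^\infty\frac{dk}{2k}[a(k)e^{-ikx}+b^\dagger(k)e^{ikx}]$, with $b=a$ in the real case and $a,b$ independent (commuting) in the complex case; $[a(k),a^\dagger(k')]=[b(k),b^\dagger(k')]=2k\,\delta(k-k')$; incoming vacuum $\Omega_o$ annihilated by all $a(k),b(k)$. Outgoing field $\hat\phi(y)=\phi(x(y))$, $y\in\mathbb R$. The thermal mean value $\langle\cdot\rangle_{\beta,in}=\mathrm{Tr}_{in}[e^{-\beta H_{in}}\,\cdot\,]/\mathrm{Tr}_{in}[e^{-\beta H_{in}}]$ in the incoming Hilbert space is understood as a limit, i.e. it is the quasi-free state with $\langle a^\dagger(k)a(k')\rangle_{\beta,in}=\langle b^\dagger(k)b(k')\rangle_{\beta,in}=\frac{2k\,\delta(k-k')}{e^{\beta k}-1}$ and all other normal-ordered two-point functions zero. The outgoing regularized energy-momentum tensor in the incoming thermal state is $$\widehat T^{Th}_{\beta,in}(y)=\lim_{\varepsilon\to0}\big[\langle\widehat\Theta_\varepsilon(y)\rangle_{\beta,in}-(\Omega_o,\Theta_\varepsilon(x(y))\Omega_o)\big],$$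 with $\Theta_\varepsilon(x)=\frac12[\partial_x\phi(x)^\dagger\partial_x\phi(x+\varepsilon)+\partial_x\phi(x+\varepsilon)^\dagger\partial_x\phi(x)]$ and $\widehat\Theta_\varepsilon(y)=\frac12[\partial_y\hat\phi(y)^\dagger\partial_y\hat\phi(y+\varepsilon)+\partial_y\hat\phi(y+\varepsilon)^\dagger\partial_y\hat\phi(y)]$ (equivalently, the thermal mean value of $\partial_y\hat\phi(y)^\dagger\partial_y\hat\phi(y)$ normal ordered with respect to the outgoing creation and annihilation operators). *)

theory Defs
  imports "HOL-Analysis.Analysis"
begin

section \<open>Operators on a complex pre-Hilbert space\<close>

text \<open>
  The type \<open>'h\<close> plays the role of the common dense invariant domain of the smeared field
  operators in the incoming Hilbert space; inner products are linear in the second argument.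
\<close>

type_synonym 'h oper = "'h \<Rightarrow> 'h"

locale pre_hilbert = vector_space scale
  for scale :: "complex \<Rightarrow> 'h::ab_group_add \<Rightarrow> 'h" +
  fixes ip :: "'h \<Rightarrow> 'h \<Rightarrow> complex"
  assumes ip_add_right: "ip u (v + w) = ip u v + ip u w"
    and ip_scale_right: "ip u (scale c v) = c * ip u v"
    and ip_commute: "ip v u = cnj (ip u v)"
    and ip_nonneg: "0 \<le> Re (ip u u)"
    and ip_definite: "ip u u = 0 \<Longrightarrow> u = 0"

definition is_adjoint :: "('h \<Rightarrow> 'h \<Rightarrow> complex) \<Rightarrow> 'h oper \<Rightarrow> 'h oper \<Rightarrow> bool" where
  "is_adjoint ip A B \<longleftrightarrow> (\<forall>u v. ip (B u) v = ip u (A v))"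

definition adj :: "('h \<Rightarrow> 'h \<Rightarrow> complex) \<Rightarrow> 'h oper \<Rightarrow> 'h oper" where
  "adj ip A = (THE B. is_adjoint ip A B)"

section \<open>Creation and annihilation operators\<close>

text \<open>
  An annihilation operator-valued distribution \<open>a(k)\<close>, \<open>k > 0\<close>, is represented by
  \<open>a f = \<integral>\<^sub>0\<^sup>\<infinity> dk/(2k) f(k) a(k)\<close>, which is linear in \<open>f\<close>.  The functions \<open>f\<close> range over
  \<open>L\<^sup>2(dk/2k)\<close> with the extra infrared condition that \<open>\<bar>f\<bar>\<^sup>2/k\<^sup>2\<close> is integrable: since
  \<open>1/(e\<^bsup>\<beta>k\<^esup> - 1)\<close> behaves as \<open>1/(\<beta>k)\<close> at \<open>0\<close>, this is what makes all thermal two-point functions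
  of the smeared operators finite, for every \<open>\<beta>\<close>.
\<close>

type_synonym 'h modes = "(real \<Rightarrow> complex) \<Rightarrow> 'h oper"

definition mode_functions :: "(real \<Rightarrow> complex) set" where
  "mode_functions = {f \<in> borel_measurable borel.
     set_integrable lborel {0<..} (\<lambda>k. (norm (f k))\<^sup>2 * (1 / (2 * k) + 1 / k\<^sup>2))}"

text \<open>\<open>create ip a f = \<integral>\<^sub>0\<^sup>\<infinity> dk/(2k) f(k) a\<^sup>\<dagger>(k)\<close>, again linear in \<open>f\<close>.\<close>

definition create :: "('h \<Rightarrow> 'h \<Rightarrow> complex) \<Rightarrow> 'h modes \<Rightarrow> 'h modes" where
  "create ip a f = adj ip (a (\<lambda>k. cnj (f k)))"

text \<open>
  The case \<open>b = a\<close> is the real field, the case \<open>b \<noteq> a\<close> the complex field: letting \<open>c\<close> and \<open>d\<close>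
  range over the set \<open>{a, b}\<close> covers both.  The relation \<open>[c(k), c\<^sup>\<dagger>(k')] = 2k \<delta>(k - k')\<close>
  smeared with \<open>f(k)/(2k)\<close> and \<open>g(k')/(2k')\<close> is \<open>[c f, c\<^sup>\<dagger> g] = \<integral>\<^sub>0\<^sup>\<infinity> dk/(2k) f(k) g(k)\<close>.
\<close>

locale incoming_modes = pre_hilbert scale ip
  for scale :: "complex \<Rightarrow> 'h::ab_group_add \<Rightarrow> 'h" and ip +
  fixes \<Omega> :: 'h and a b :: "'h modes"
  assumes oper_linear: "\<lbrakk>c \<in> {a, b}; f \<in> mode_functions\<rbrakk> \<Longrightarrow> Vector_Spaces.linear scale scale (c f)"
    and oper_adjoint: "\<lbrakk>c \<in> {a, b}; f \<in> mode_functions\<rbrakk> \<Longrightarrow> \<exists>B. is_adjoint ip (c f) B"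
    and smear_add: "\<lbrakk>c \<in> {a, b}; f \<in> mode_functions; g \<in> mode_functions\<rbrakk> \<Longrightarrow>
      c (\<lambda>k. f k + g k) = (\<lambda>u. c f u + c g u)"
    and smear_scale: "\<lbrakk>c \<in> {a, b}; f \<in> mode_functions\<rbrakk> \<Longrightarrow>
      c (\<lambda>k. z * f k) = (\<lambda>u. scale z (c f u))"
    and commutator_annihilate:
      "\<lbrakk>c \<in> {a, b}; d \<in> {a, b}; f \<in> mode_functions; g \<in> mode_functions\<rbrakk> \<Longrightarrow>
      c f (d g u) - d g (c f u) = 0"
    and commutator_create:
      "\<lbrakk>c \<in> {a, b}; d \<in> {a, b}; f \<in> mode_functions; g \<in> mode_functions\<rbrakk> \<Longrightarrow>
      c f (create ip d g u) - create ip d g (c f u) =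
        scale (if c = d then LINT k:{0<..}|lborel. f k * g k / of_real (2 * k) else 0) u"
    and vacuum_unit: "ip \<Omega> \<Omega> = 1"
    and vacuum_annihilated: "\<lbrakk>c \<in> {a, b}; f \<in> mode_functions\<rbrakk> \<Longrightarrow> c f \<Omega> = 0"

definition vacuum_mean :: "('h \<Rightarrow> 'h \<Rightarrow> complex) \<Rightarrow> 'h \<Rightarrow> 'h oper \<Rightarrow> complex" where
  "vacuum_mean ip \<Omega> A = ip \<Omega> (A \<Omega>)"

section \<open>The thermal state\<close>

definition mode_operators :: "('h \<Rightarrow> 'h \<Rightarrow> complex) \<Rightarrow> 'h modes \<Rightarrow> 'h modes \<Rightarrow> 'h oper set" where
  "mode_operators ip a b =
     (\<Union>c\<in>{a, b}. \<Union>f\<in>mode_functions. {c f, create ip c f})"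

inductive_set field_algebra ::
    "(complex \<Rightarrow> 'h::ab_group_add \<Rightarrow> 'h) \<Rightarrow> ('h \<Rightarrow> 'h \<Rightarrow> complex) \<Rightarrow> 'h modes \<Rightarrow> 'h modes \<Rightarrow> 'h oper set"
  for scale ip a b where
    gen: "A \<in> mode_operators ip a b \<Longrightarrow> A \<in> field_algebra scale ip a b"
  | one: "id \<in> field_algebra scale ip a b"
  | add: "\<lbrakk>A \<in> field_algebra scale ip a b; B \<in> field_algebra scale ip a b\<rbrakk> \<Longrightarrow>
      (\<lambda>u. A u + B u) \<in> field_algebra scale ip a b"
  | scl: "A \<in> field_algebra scale ip a b \<Longrightarrow> (\<lambda>u. scale z (A u)) \<in> field_algebra scale ip a b"
  | mul: "\<lbrakk>A \<in> field_algebra scale ip a b; B \<in> field_algebra scale ip a b\<rbrakk> \<Longrightarrow>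
      A \<circ> B \<in> field_algebra scale ip a b"

text \<open>
  The sum over all pairings of the factors of a product, each pair contributing its two-point
  function in the given order; it is \<open>0\<close> for an odd number of factors.
\<close>

fun wick :: "('h oper \<Rightarrow> 'h oper \<Rightarrow> complex) \<Rightarrow> 'h oper list \<Rightarrow> complex" where
  "wick w [] = 1"
| "wick w (A # As) =
     (\<Sum>i<length As. w A (As ! i) * wick w (take i As @ drop (Suc i) As))"

text \<open>
  The state \<open>\<omega>\<close> is a functional on \<open>field_algebra\<close>; its values on other maps are irrelevant.
  The anti-normal-ordered two-point functions follow from the commutation relations.
\<close>

locale thermal_state = incoming_modes scale ip \<Omega> a b
  for scale :: "complex \<Rightarrow> 'h::ab_group_add \<Rightarrow> 'h" and ip \<Omega> a b +
  fixes \<beta> :: real and \<omega> :: "'h oper \<Rightarrow> complex"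
  assumes state_add: "\<lbrakk>A \<in> field_algebra scale ip a b; B \<in> field_algebra scale ip a b\<rbrakk> \<Longrightarrow>
      \<omega> (\<lambda>u. A u + B u) = \<omega> A + \<omega> B"
    and state_scale: "A \<in> field_algebra scale ip a b \<Longrightarrow> \<omega> (\<lambda>u. scale z (A u)) = z * \<omega> A"
    and state_one: "\<omega> id = 1"
    and state_positive: "A \<in> field_algebra scale ip a b \<Longrightarrow> \<omega> (adj ip A \<circ> A) \<in> \<real>\<^sub>\<ge>\<^sub>0"
    and quasi_free: "set As \<subseteq> mode_operators ip a b \<Longrightarrow>
      \<omega> (foldr (\<circ>) As id) = wick (\<lambda>A B. \<omega> (A \<circ> B)) As"
    and thermal_two_point:
      "\<lbrakk>c \<in> {a, b}; d \<in> {a, b}; f \<in> mode_functions; g \<in> mode_functions\<rbrakk> \<Longrightarrow>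
      \<omega> (create ip c f \<circ> d g) =
        (if c = d then LINT k:{0<..}|lborel. f k * g k / of_real (2 * k * (exp (\<beta> * k) - 1))
         else 0)"
    and annihilate_two_point:
      "\<lbrakk>c \<in> {a, b}; d \<in> {a, b}; f \<in> mode_functions; g \<in> mode_functions\<rbrakk> \<Longrightarrow>
      \<omega> (c f \<circ> d g) = 0"
    and create_two_point:
      "\<lbrakk>c \<in> {a, b}; d \<in> {a, b}; f \<in> mode_functions; g \<in> mode_functions\<rbrakk> \<Longrightarrow>
      \<omega> (create ip c f \<circ> create ip d g) = 0"

section \<open>Fields and their two-point functions\<close>

definition support :: "(real \<Rightarrow> complex) \<Rightarrow> real set" where
  "support F = closure {x. F x \<noteq> 0}"

definition test_function :: "(real \<Rightarrow> complex) \<Rightarrow> bool" where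
  "test_function F \<longleftrightarrow> compact (support F) \<and>
     (\<exists>D. D 0 = F \<and> (\<forall>n x. (D n has_vector_derivative D (Suc n) x) (at x)))"

text \<open>
  \<open>field ip a b X F\<close> is \<open>\<integral> F(y) \<phi>(X(y)) dy\<close>, with the mode expansion of \<open>\<phi>\<close> inserted: the
  coefficient functions of \<open>a(k)\<close> and \<open>b\<^sup>\<dagger>(k)\<close> with respect to \<open>dk/(2k)\<close> are
  \<open>(2\<pi>)\<^bsup>-1/2\<^esup> \<integral> F(y) e\<^bsup>-ikX(y)\<^esup> dy\<close> and \<open>(2\<pi>)\<^bsup>-1/2\<^esup> \<integral> F(y) e\<^bsup>ikX(y)\<^esup> dy\<close>.  Thus \<open>X = id\<close> gives \<open>\<phi>\<close>
  itself and \<open>X(y) = x(y)\<close> the outgoing field.  Massless fields need smearing functions with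
  vanishing integral for these coefficients to be in \<open>mode_functions\<close>, and this is the case in
  \<open>deriv_field\<close>, the distributional derivative \<open>\<integral> F(y) \<partial>\<^sub>y \<phi>(X(y)) dy = - \<integral> F'(y) \<phi>(X(y)) dy\<close>.
\<close>

definition mode_coeff :: "(real \<Rightarrow> real) \<Rightarrow> (real \<Rightarrow> complex) \<Rightarrow> real \<Rightarrow> complex" where
  "mode_coeff X F k = (LINT y|lborel. F y * cis (- k * X y)) / of_real (sqrt (2 * pi))"

definition field ::
    "('h \<Rightarrow> 'h \<Rightarrow> complex) \<Rightarrow> 'h::ab_group_add modes \<Rightarrow> 'h modes \<Rightarrow> (real \<Rightarrow> real) \<Rightarrow> 'h modes" where
  "field ip a b X F =
     (\<lambda>u. a (mode_coeff X F) u + create ip b (\<lambda>k. mode_coeff X F (- k)) u)"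

definition deriv_field ::
    "('h \<Rightarrow> 'h \<Rightarrow> complex) \<Rightarrow> 'h::ab_group_add modes \<Rightarrow> 'h modes \<Rightarrow> (real \<Rightarrow> real) \<Rightarrow> 'h modes" where
  "deriv_field ip a b X F = field ip a b X (\<lambda>y. - vector_derivative F (at y))"

text \<open>
  \<open>W\<close> is the integral kernel, away from the diagonal, of the distribution
  \<open>\<langle>\<partial>\<^sub>y\<phi>(X(y))\<^sup>\<dagger> \<partial>\<^sub>y\<phi>(X(y'))\<rangle>\<close> in the functional \<open>E\<close>.  Conjugating \<open>F\<close> before taking the adjoint
  makes the smeared \<open>\<partial>\<^sub>y\<phi>(X(y))\<^sup>\<dagger>\<close> linear in \<open>F\<close>.
\<close>

definition two_point_kernel ::
    "('h \<Rightarrow> 'h \<Rightarrow> complex) \<Rightarrow> 'h::ab_group_add modes \<Rightarrow> 'h modes \<Rightarrow> ('h oper \<Rightarrow> complex) \<Rightarrow>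
     (real \<Rightarrow> real) \<Rightarrow> (real \<Rightarrow> real \<Rightarrow> complex) \<Rightarrow> bool" where
  "two_point_kernel ip a b E X W \<longleftrightarrow>
     continuous_on {p. fst p \<noteq> snd p} (\<lambda>p. W (fst p) (snd p)) \<and>
     (\<forall>F G. test_function F \<and> test_function G \<and> support F \<inter> support G = {} \<longrightarrow>
        E (adj ip (deriv_field ip a b X (\<lambda>y. cnj (F y))) \<circ> deriv_field ip a b X G) =
        (LINT p|lborel. F (fst p) * G (snd p) * W (fst p) (snd p)))"

text \<open>The value \<open>\<langle>\<partial>\<^sub>y\<phi>(X(y))\<^sup>\<dagger> \<partial>\<^sub>y\<phi>(X(y'))\<rangle>\<close> at separate points \<open>y \<noteq> y'\<close>.\<close>

definition two_point ::
    "('h \<Rightarrow> 'h \<Rightarrow> complex) \<Rightarrow> 'h::ab_group_add modes \<Rightarrow> 'h modes \<Rightarrow> ('h oper \<Rightarrow> complex) \<Rightarrow>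
     (real \<Rightarrow> real) \<Rightarrow> real \<Rightarrow> real \<Rightarrow> complex" where
  "two_point ip a b E X y y' = (THE c. \<exists>W. two_point_kernel ip a b E X W \<and> c = W y y')"

section \<open>The energy-momentum tensor\<close>

definition mean_Theta ::
    "('h \<Rightarrow> 'h \<Rightarrow> complex) \<Rightarrow> 'h::ab_group_add modes \<Rightarrow> 'h modes \<Rightarrow> ('h oper \<Rightarrow> complex) \<Rightarrow>
     (real \<Rightarrow> real) \<Rightarrow> real \<Rightarrow> real \<Rightarrow> complex" where
  "mean_Theta ip a b E X \<epsilon> y =
     (two_point ip a b E X y (y + \<epsilon>) + two_point ip a b E X (y + \<epsilon>) y) / 2"

definition split_emt ::
    "('h \<Rightarrow> 'h \<Rightarrow> complex) \<Rightarrow> 'h \<Rightarrow> 'h::ab_group_add modes \<Rightarrow> 'h modes \<Rightarrow> ('h oper \<Rightarrow> complex) \<Rightarrow>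
     (real \<Rightarrow> real) \<Rightarrow> real \<Rightarrow> real \<Rightarrow> complex" where
  "split_emt ip \<Omega> a b \<omega> X \<epsilon> y =
     mean_Theta ip a b \<omega> X \<epsilon> y - mean_Theta ip a b (vacuum_mean ip \<Omega>) (\<lambda>x. x) \<epsilon> (X y)"

definition outgoing_emt ::
    "('h \<Rightarrow> 'h \<Rightarrow> complex) \<Rightarrow> 'h \<Rightarrow> 'h::ab_group_add modes \<Rightarrow> 'h modes \<Rightarrow> ('h oper \<Rightarrow> complex) \<Rightarrow>
     (real \<Rightarrow> real) \<Rightarrow> real \<Rightarrow> complex" where
  "outgoing_emt ip \<Omega> a b \<omega> X y = Lim (at 0) (\<lambda>\<epsilon>. split_emt ip \<Omega> a b \<omega> X \<epsilon> y)"

text \<open>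
  The descriptions in \<open>two_point\<close> and \<open>outgoing_emt\<close> denote: both kernels exist, and so does the
  limit that removes the point splitting.
\<close>

definition outgoing_emt_exists ::
    "('h \<Rightarrow> 'h \<Rightarrow> complex) \<Rightarrow> 'h \<Rightarrow> 'h::ab_group_add modes \<Rightarrow> 'h modes \<Rightarrow> ('h oper \<Rightarrow> complex) \<Rightarrow>
     (real \<Rightarrow> real) \<Rightarrow> bool" where
  "outgoing_emt_exists ip \<Omega> a b \<omega> X \<longleftrightarrow>
     (\<exists>W. two_point_kernel ip a b \<omega> X W) \<and>
     (\<exists>W. two_point_kernel ip a b (vacuum_mean ip \<Omega>) (\<lambda>x. x) W) \<and>
     (\<forall>y. \<exists>l. ((\<lambda>\<epsilon>. split_emt ip \<Omega> a b \<omega> X \<epsilon> y) \<longlongrightarrow> l) (at 0))"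

definition thermal_emt_out :: "real \<Rightarrow> real" where
  "thermal_emt_out \<beta> = pi / (12 * \<beta>\<^sup>2)"

definition relativistic_black_hole :: "real \<Rightarrow> real" where
  "relativistic_black_hole y = - exp (- y)"

definition cghs_black_hole :: "real \<Rightarrow> real" where
  "cghs_black_hole y = - ln (1 + exp (- y))"

end

theory Submission
  imports Defs "HOL-Real_Asymp.Real_Asymp"
begin

text \<open>
  With \<open>d = X(y) - X(y')\<close>, the thermal two-point kernel of the outgoing field is
  \<open>X'(y) X'(y')/(4\<pi>)\<close> times \<open>- 1/d\<^sup>2 + \<integral>\<^sub>0\<^sup>\<infinity> 2k cos(kd)/(e\<^bsup>\<beta>k\<^esup> - 1) dk\<close>; the first term is the
  Abel-regularised vacuum part.  Expanding the Bose factor in a geometric series turns the bracket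
  into the sum of \<open>1/(m\<beta> + id)\<^sup>2\<close> over all integers \<open>m\<close>, that is, \<open>- (\<pi>/\<beta>)\<^sup>2/sinh\<^sup>2(\<pi>d/\<beta>)\<close>.  Removing
  the point splitting by a third-order Taylor expansion gives
  \<open>\<pi>/(12\<beta>\<^sup>2) X'\<^sup>2 - S(X)/(24\<pi>)\<close> with the Schwarzian derivative \<open>S(X) = X'''/X' - 3/2 (X''/X')\<^sup>2\<close>.
  At late times \<open>X' \<rightarrow> 0\<close> and \<open>S(X) \<rightarrow> -1/2\<close>, hence the value \<open>1/(48\<pi>)\<close>; for the CGHS model
  at early times \<open>X' \<rightarrow> 1\<close> and \<open>S(X) \<rightarrow> 0\<close>.
\<close>

section \<open>Laplace transforms and the Bose integral\<close>

text \<open>The two-point function at separate points is not a given number: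
  \<open>two_point\<close> picks the value of a kernel that is known only through its integrals
  against test functions of disjoint support. Existence and uniqueness of the kernel therefore
  precede any computation. Existence goes through mode integrals. Of the four products in the
  smeared two-point function two have mean zero, one is normal ordered and one is not, which leaves
  the occupation number \<nu> once and \<open>1 + \<nu>\<close> once. The terms with \<nu> converge
  absolutely, so the order of mode and position integrals is free; the 1 does not, since its weight
  \<open>k\<close> is not integrable, and this is the origin of the Abel factor. Disjoint supports
  keep \<open>d\<close> away from 0, so that the boundary value \<open>- 1 / d^2\<close> appears as
  an ordinary function and not as a distribution with an i0 prescription. No step compares
  \<open>a\<close> with \<open>b\<close>, which is why the real and the complex field need no case
  distinction.\<close>

lemma laplace_ident_real:
  fixes s :: real
  assumes "s > 0"
  shows "set_integrable lborel {0<..} (\<lambda>k. k * exp (- s * k))"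
    and "(LINT k:{0<..}|lborel. k * exp (- s * k)) = 1 / s\<^sup>2"
proof -
  define F where "F = (\<lambda>k. - (k / s + 1 / s\<^sup>2) * exp (- s * k))"
  have D: "(F has_real_derivative k * exp (- s * k)) (at k)" for k
    unfolding F_def using assms
    by (auto intro!: derivative_eq_intros simp: field_simps power2_eq_square)
  have lim0: "((F \<circ> real_of_ereal) \<longlongrightarrow> - (1 / s\<^sup>2)) (at_right 0)"
    unfolding zero_ereal_def ereal_tendsto_simps F_def
    using assms by (auto intro!: tendsto_eq_intros)
  have liminf: "((F \<circ> real_of_ereal) \<longlongrightarrow> 0) (at_left \<infinity>)"
    unfolding ereal_tendsto_simps F_def using assms by real_asymp
  note I = interval_integral_FTC_nonneg[of 0 \<infinity> F "\<lambda>k. k * exp (- s * k)" "- (1 / s\<^sup>2)" 0]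
  have E: "einterval 0 \<infinity> = {0<..}"
    by (simp add: einterval_eq_Ici zero_ereal_def)
  show "set_integrable lborel {0<..} (\<lambda>k. k * exp (- s * k))"
    unfolding E[symmetric] using D lim0 liminf by (intro I(1)) auto
  have "(LBINT k=0..\<infinity>. k * exp (- s * k)) = 0 - (- (1 / s\<^sup>2))"
    using D lim0 liminf by (intro I(2)) auto
  then show "(LINT k:{0<..}|lborel. k * exp (- s * k)) = 1 / s\<^sup>2"
    by (simp add: interval_lebesgue_integral_def E)
qed

text \<open>For nonnegative integrands the fundamental theorem on an improper interval also yields
  integrability; for complex ones integrability must be known beforehand. The real case at
  \<open>Re z\<close> is the majorant that supplies it.\<close>

lemma laplace_ident:
  fixes z :: complex
  assumes "Re z > 0"
  shows "set_integrable lborel {0<..} (\<lambda>k. of_real k * exp (- z * of_real k))"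
    and "(LINT k:{0<..}|lborel. of_real k * exp (- z * of_real k)) = 1 / z\<^sup>2"
proof -
  define F where "F = (\<lambda>k::real. - (of_real k / z + 1 / z\<^sup>2) * exp (- z * of_real k))"
  have z: "z \<noteq> 0" using assms by auto
  have D: "(F has_vector_derivative of_real k * exp (- z * of_real k)) (at k)" for k
  proof -
    have "((\<lambda>w. - (w / z + 1 / z\<^sup>2) * exp (- z * w)) has_field_derivative
        of_real k * exp (- z * of_real k)) (at (of_real k))"
      using z by (auto intro!: derivative_eq_intros simp: field_simps power2_eq_square)
    then show ?thesis unfolding F_def by (rule has_vector_derivative_real_field)
  qed
  have lim0: "((F \<circ> real_of_ereal) \<longlongrightarrow> - (1 / z\<^sup>2)) (at_right 0)"
    unfolding zero_ereal_def ereal_tendsto_simps F_def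
    by (rule tendsto_eq_intros | simp add: z)+
  have liminf: "((F \<circ> real_of_ereal) \<longlongrightarrow> 0) (at_left \<infinity>)"
    unfolding ereal_tendsto_simps
  proof (rule Lim_null_comparison)
    show "\<forall>\<^sub>F k in at_top. norm (F k) \<le> (k / norm z + 1 / (norm z)\<^sup>2) * exp (- Re z * k)"
      using eventually_ge_at_top[of 0]
    proof eventually_elim
      case (elim k)
      have "norm (F k) = norm (of_real k / z + 1 / z\<^sup>2) * exp (- Re z * k)"
        by (simp add: F_def norm_mult norm_minus_commute flip: norm_minus_cancel[of "of_real k / z + 1 / z\<^sup>2"])
      also have "norm (of_real k / z + 1 / z\<^sup>2) \<le> k / norm z + 1 / (norm z)\<^sup>2"
        using elim by (intro order_trans[OF norm_triangle_ineq]) (simp add: norm_divide norm_power)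
      finally show ?case by simp
    qed
    have "norm z > 0" using z by simp
    then show "((\<lambda>k. (k / norm z + 1 / (norm z)\<^sup>2) * exp (- Re z * k)) \<longlongrightarrow> 0) at_top"
      using assms by real_asymp
  qed
  have E: "einterval 0 \<infinity> = {0<..}"
    by (simp add: einterval_eq_Ici zero_ereal_def)
  show int: "set_integrable lborel {0<..} (\<lambda>k. of_real k * exp (- z * of_real k))"
    unfolding set_integrable_def
  proof (rule Bochner_Integration.integrable_bound)
    show "integrable lborel (\<lambda>k. indicator {0<..} k *\<^sub>R (k * exp (- Re z * k)))"
      using laplace_ident_real(1)[OF assms] by (simp add: set_integrable_def)
  qed (auto simp: norm_mult indicator_def)
  have "(LBINT k=0..\<infinity>. of_real k * exp (- z * of_real k)) = 0 - (- (1 / z\<^sup>2))"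
    using D lim0 liminf int
    by (intro interval_integral_FTC_integrable[of 0 \<infinity> F]) (auto simp: E intro!: continuous_intros)
  then show "(LINT k:{0<..}|lborel. of_real k * exp (- z * of_real k)) = 1 / z\<^sup>2"
    by (simp add: interval_lebesgue_integral_def E)
qed

text \<open>The second logarithmic derivative of Euler's reflection formula.\<close>

lemma trigamma_reflection:
  fixes z :: complex
  assumes "z \<notin> \<int>"
  shows "Polygamma 1 z + Polygamma 1 (1 - z) = (of_real pi / sin (of_real pi * z))\<^sup>2"
proof -
  have sin0: "sin (of_real pi * w) \<noteq> 0" if "w \<notin> \<int>" for w :: complex
    using that Gamma_reflection_complex[of w]
    by (metis Ints_1 Ints_diff Gamma_eq_zero_iff divide_eq_0_iff mult_eq_0_iff nonpos_Ints_subset_Ints diff_diff_eq2 add_diff_cancel_left' subsetD)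
  have dig: "Digamma w - Digamma (1 - w) = - (of_real pi * cos (of_real pi * w) / sin (of_real pi * w))"
    if w: "w \<notin> \<int>" for w :: complex
  proof -
    have w': "w \<notin> \<int>\<^sub>\<le>\<^sub>0" "1 - w \<notin> \<int>\<^sub>\<le>\<^sub>0"
      using w Ints_diff[of 1 "1 - w"] nonpos_Ints_subset_Ints by auto
    \<comment> \<open>The reflection formula makes \<open>?g\<close> constant off the integers. Its
      product-rule derivative is therefore 0, and cancelling the nonzero Gamma factors leaves the
      cotangent formula for \<open>Digamma\<close>.\<close>
    let ?g = "\<lambda>w::complex. Gamma w * Gamma (1 - w) * sin (of_real pi * w)"
    have op: "open (- \<int> :: complex set)" by (simp add: closed_Ints flip: closed_def)
    have c: "?g v = of_real pi" if "v \<in> - \<int>" for v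
      using Gamma_reflection_complex[of v] sin0[of v] that by simp
    have "(?g has_field_derivative 0) (at w)"
      using has_field_derivative_transform_within_open[OF DERIV_const op, of w] c w
      by (metis (mono_tags, lifting) ComplI)
    moreover have "(?g has_field_derivative
        Gamma w * Gamma (1 - w) * ((Digamma w - Digamma (1 - w)) * sin (of_real pi * w)
          + of_real pi * cos (of_real pi * w))) (at w)"
      using w' by (auto intro!: derivative_eq_intros simp: algebra_simps)
    ultimately have "Gamma w * Gamma (1 - w) * ((Digamma w - Digamma (1 - w)) * sin (of_real pi * w)
          + of_real pi * cos (of_real pi * w)) = 0"
      using DERIV_unique by blast
    then have "(Digamma w - Digamma (1 - w)) * sin (of_real pi * w) = - (of_real pi * cos (of_real pi * w))"
      using w' by (simp add: Gamma_eq_zero_iff add_eq_0_iff)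
    then show ?thesis using sin0[OF w] by (simp add: field_simps)
  qed
  have z': "z \<notin> \<int>\<^sub>\<le>\<^sub>0" "1 - z \<notin> \<int>\<^sub>\<le>\<^sub>0"
      using assms Ints_diff[of 1 "1 - z"] nonpos_Ints_subset_Ints by auto
  have op: "open (- \<int> :: complex set)" by (simp add: closed_Ints flip: closed_def)
  have s: "sin (of_real pi * z) \<noteq> 0" using sin0 assms by auto
  let ?r = "\<lambda>w::complex. - (of_real pi * cos (of_real pi * w) / sin (of_real pi * w))"
  have "((\<lambda>w. Digamma w - Digamma (1 - w)) has_field_derivative
      Polygamma 1 z + Polygamma 1 (1 - z)) (at z)"
    using z' by (auto intro!: derivative_eq_intros)
  moreover have "(?r has_field_derivative (of_real pi / sin (of_real pi * z))\<^sup>2) (at z)"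
  proof -
    let ?s = "sin (of_real pi * z)" and ?c = "cos (of_real pi * z)"
    have "- ((- (of_real pi * ?s * of_real pi) * ?s - of_real pi * ?c * (?c * of_real pi)) / (?s * ?s))
        = (of_real pi)\<^sup>2 * (?s\<^sup>2 + ?c\<^sup>2) / ?s\<^sup>2"
      using s by (simp add: field_simps power2_eq_square del: sin_cos_squared_add sin_cos_squared_add3)
    also have "\<dots> = (of_real pi / ?s)\<^sup>2"
      by (simp add: power_divide)
    finally have "- ((- (of_real pi * ?s * of_real pi) * ?s - of_real pi * ?c * (?c * of_real pi)) / (?s * ?s))
        = (of_real pi / ?s)\<^sup>2" .
    moreover have "(?r has_field_derivative
        - ((- (of_real pi * ?s * of_real pi) * ?s - of_real pi * ?c * (?c * of_real pi)) / (?s * ?s))) (at z)"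
      using s by (auto intro!: derivative_eq_intros simp: algebra_simps)
    ultimately show ?thesis by simp
  qed
  then have "((\<lambda>w. Digamma w - Digamma (1 - w)) has_field_derivative (of_real pi / sin (of_real pi * z))\<^sup>2) (at z)"
    using has_field_derivative_transform_within_open[OF _ op, of ?r _ z] dig assms
    by (metis (mono_tags, lifting) ComplD ComplI)
  ultimately show ?thesis using DERIV_unique by blast
qed

text \<open>Partial fractions of the squared cosecant, with the term of index 0 moved to the right:
  the trigamma series at \<open>z + 1\<close> and \<open>1 - z\<close> carry the integers of either
  sign, and shifting the first back to \<open>z\<close> costs \<open>1 / z^2\<close>. Leaving out
  index 0 matches the Bose series, which starts at 1.\<close>

lemma csc_squared_sums:
  fixes z :: complex
  assumes "z \<notin> \<int>"
  shows "(\<lambda>n. 1 / (of_nat (Suc n) + z)\<^sup>2 + 1 / (of_nat (Suc n) - z)\<^sup>2) sums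
           ((of_real pi / sin (of_real pi * z))\<^sup>2 - 1 / z\<^sup>2)"
proof -
  have z': "z \<noteq> 0" "z + 1 \<notin> \<int>\<^sub>\<le>\<^sub>0" "1 - z \<notin> \<int>\<^sub>\<le>\<^sub>0"
    using assms Ints_diff[of 1 "1 - z"] Ints_diff[of "z + 1" 1] nonpos_Ints_subset_Ints by auto
  have nz: "w \<noteq> 0" if "w \<notin> \<int>\<^sub>\<le>\<^sub>0" for w :: complex using that by auto
  have "(\<lambda>n. inverse ((z + 1 + of_nat n) ^ 2)) sums Polygamma 1 (z + 1)"
    using Polygamma_LIMSEQ[OF nz[OF z'(2)], of 1] by (simp add: numeral_2_eq_2)
  moreover have "(\<lambda>n. inverse ((1 - z + of_nat n) ^ 2)) sums Polygamma 1 (1 - z)"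
    using Polygamma_LIMSEQ[OF nz[OF z'(3)], of 1] by (simp add: numeral_2_eq_2)
  ultimately have "(\<lambda>n. inverse ((z + 1 + of_nat n) ^ 2) + inverse ((1 - z + of_nat n) ^ 2)) sums
     (Polygamma 1 (z + 1) + Polygamma 1 (1 - z))" by (rule sums_add)
  also have "Polygamma 1 (z + 1) + Polygamma 1 (1 - z) = (of_real pi / sin (of_real pi * z))\<^sup>2 - 1 / z\<^sup>2"
    using Polygamma_plus1[OF z'(1), of 1] trigamma_reflection[OF assms, symmetric]
    by (simp add: numeral_2_eq_2)
  finally show ?thesis by (simp add: inverse_eq_divide algebra_simps)
qed

section \<open>Series, integrability and cosine transform of the Bose factor\<close>

lemma borel_measurable_cis [measurable]: "cis \<in> borel_measurable borel"
  by (intro borel_measurable_continuous_onI continuous_intros)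

lemma bose_series:
  fixes k :: real
  assumes "\<beta> > 0" "k > 0"
  shows "(\<lambda>n. k * exp (- (real (Suc n) * \<beta>) * k)) sums (k / (exp (\<beta> * k) - 1))"
proof -
  have e: "exp (- (\<beta> * k)) < 1" using assms by simp
  have "(\<lambda>n. k * exp (- (\<beta> * k)) * exp (- (\<beta> * k)) ^ n) sums
      (k * exp (- (\<beta> * k)) * (1 / (1 - exp (- (\<beta> * k)))))"
    using e by (intro sums_mult geometric_sums) simp
  moreover have "k * exp (- (\<beta> * k)) * exp (- (\<beta> * k)) ^ n = k * exp (- (real (Suc n) * \<beta>) * k)" for n
    by (simp add: algebra_simps flip: exp_of_nat_mult exp_add)
  moreover have "k * exp (- (\<beta> * k)) * (1 / (1 - exp (- (\<beta> * k)))) = k / (exp (\<beta> * k) - 1)"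
  proof -
    have "exp (\<beta> * k) > 1" using assms by simp
    then show ?thesis by (simp add: exp_minus field_simps)
  qed
  ultimately show ?thesis by simp
qed

lemma inverse_squares_scaled_summable:
  fixes \<beta> :: real
  shows "summable (\<lambda>n. 1 / (real (Suc n) * \<beta>)\<^sup>2)"
proof -
  have "summable (\<lambda>n. 1 / real (Suc n) ^ 2 * (1 / \<beta>\<^sup>2))"
    by (intro summable_mult2) (use inverse_squares_sums in \<open>simp add: sums_iff add.commute\<close>)
  then show ?thesis by (simp add: power_mult_distrib)
qed

text \<open>The terms of the Bose series are nonnegative with integrals
  \<open>1 / (real (Suc n) * \<beta>)^2\<close>, so termwise integration rests on the convergence of
  the inverse squares.\<close>

lemma bose_integrable:
  fixes \<beta> :: real
  assumes "\<beta> > 0"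
  shows "set_integrable lborel {0<..} (\<lambda>k. k / (exp (\<beta> * k) - 1))"
proof -
  define g where "g = (\<lambda>n k. indicator {0<..} k *\<^sub>R (k * exp (- (real (Suc n) * \<beta>) * k)))"
  have pos: "real (Suc n) * \<beta> > 0" for n using assms by simp
  have g_pos: "g n k \<ge> 0" for n k by (simp add: g_def indicator_def)
  have g_sums: "(\<lambda>n. g n k) sums (indicator {0<..} k *\<^sub>R (k / (exp (\<beta> * k) - 1)))" for k
    using bose_series[OF assms, of k] by (cases "k > 0") (auto simp: g_def)
  have "integrable lborel (\<lambda>k. \<Sum>n. g n k)"
  proof (rule integrable_suminf)
    show "integrable lborel (g n)" for n
      using laplace_ident_real(1)[OF pos[of n]] by (simp add: set_integrable_def g_def)
    show "AE k in lborel. summable (\<lambda>n. norm (g n k))"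
      using g_sums g_pos by (auto simp: sums_iff)
    have "(LINT k|lborel. norm (g n k)) = 1 / (real (Suc n) * \<beta>)\<^sup>2" for n
      using laplace_ident_real(2)[OF pos[of n]] g_pos
      by (simp add: set_lebesgue_integral_def g_def del: of_nat_Suc)
    then show "summable (\<lambda>n. LINT k|lborel. norm (g n k))"
      using inverse_squares_scaled_summable by simp
  qed
  then show ?thesis using g_sums by (simp add: sums_iff set_integrable_def)
qed

text \<open>The phases shift the Laplace parameter \<open>t n\<close> by plus or minus i d. The
  integrated series is thus a partial fraction series evaluated on the imaginary axis, where the
  squared cosecant becomes a squared hyperbolic sine.\<close>

lemma bose_cosine_transform:
  fixes \<beta> d :: real
  assumes "\<beta> > 0" "d \<noteq> 0"
  shows "(LINT k:{0<..}|lborel. of_real (k / (exp (\<beta> * k) - 1)) * (cis (k * d) + cis (- k * d)))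
     = of_real (1 / d\<^sup>2 - (pi / \<beta>)\<^sup>2 / (sinh (pi * d / \<beta>))\<^sup>2)"
proof -
  define t where "t = (\<lambda>n. real (Suc n) * \<beta>)"
  have pos: "t n > 0" for n using assms by (simp add: t_def)
  define g where "g = (\<lambda>n k. indicator {0<..} k *\<^sub>R (k * exp (- t n * k)))"
  have g_int: "integrable lborel (g n)" for n
    using laplace_ident_real(1)[OF pos[of n]] by (simp add: set_integrable_def g_def)
  define h where "h = (\<lambda>n k. of_real (g n k) * (cis (k * d) + cis (- k * d)))"
  have g_pos: "g n k \<ge> 0" for n k by (simp add: g_def indicator_def)
  have h_le: "norm (h n k) \<le> 2 * g n k" for n k
  proof -
    have "norm (cis (k * d) + cis (- k * d)) \<le> 2"
      using norm_triangle_ineq[of "cis (k * d)" "cis (- k * d)"] by simp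
    from mult_left_mono[OF this g_pos[of n k]] g_pos[of n k] show ?thesis
      by (simp add: h_def norm_mult mult.commute)
  qed
  have g_sums: "(\<lambda>n. g n k) sums (indicator {0<..} k *\<^sub>R (k / (exp (\<beta> * k) - 1)))" for k
    using bose_series[OF assms(1), of k] by (cases "k > 0") (auto simp: g_def t_def)
  have h_int: "integrable lborel (h n)" for n
  proof (rule Bochner_Integration.integrable_bound)
    show "integrable lborel (\<lambda>k. 2 * g n k)" using g_int by simp
    show "h n \<in> borel_measurable lborel"
      unfolding h_def g_def by measurable
    show "AE k in lborel. norm (h n k) \<le> norm (2 * g n k)"
      using h_le g_pos by (auto simp: abs_of_nonneg)
  qed
  have h_eq: "h n k = indicator {0<..} k *\<^sub>R (of_real k * exp (- (of_real (t n) - \<i> * of_real d) * of_real k))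
      + indicator {0<..} k *\<^sub>R (of_real k * exp (- (of_real (t n) + \<i> * of_real d) * of_real k))" for n k
    by (auto simp: h_def g_def cis_conv_exp indicator_def algebra_simps exp_of_real[symmetric] simp flip: exp_add)
  have h_val: "integral\<^sup>L lborel (h n) = 1 / (of_real (t n) - \<i> * of_real d)\<^sup>2 + 1 / (of_real (t n) + \<i> * of_real d)\<^sup>2" for n
  proof -
    have "Re (of_real (t n) - \<i> * of_real d) > 0" "Re (of_real (t n) + \<i> * of_real d) > 0"
      using pos by auto
    note L = laplace_ident[OF this(1)] laplace_ident[OF this(2)]
    have "integral\<^sup>L lborel (h n) =
       (LINT k:{0<..}|lborel. of_real k * exp (- (of_real (t n) - \<i> * of_real d) * of_real k))
       + (LINT k:{0<..}|lborel. of_real k * exp (- (of_real (t n) + \<i> * of_real d) * of_real k))"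
      using L(1,3) unfolding h_eq set_lebesgue_integral_def set_integrable_def
      by (rule Bochner_Integration.integral_add)
    then show ?thesis by (simp only: L(2,4))
  qed
  have int_sums: "(\<lambda>n. integral\<^sup>L lborel (h n)) sums (LINT k|lborel. (\<Sum>n. h n k))"
  proof (rule sums_integral)
    show "integrable lborel (h n)" for n by (rule h_int)
    have "summable (\<lambda>n. norm (h n k))" for k
      by (rule summable_comparison_test'[of "\<lambda>n. 2 * g n k" 0])
         (use h_le g_sums[of k] in \<open>auto intro!: summable_mult simp: sums_iff\<close>)
    then show "AE k in lborel. summable (\<lambda>n. norm (h n k))" by simp
    have h_norm_le: "(LINT k|lborel. norm (h n k)) \<le> 2 * (1 / (t n)\<^sup>2)" for n
    proof -
      have "(LINT k|lborel. norm (h n k)) \<le> (LINT k|lborel. 2 * g n k)"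
        using h_int g_int h_le by (intro integral_mono) auto
      also have "\<dots> = 2 * (1 / (t n)\<^sup>2)"
        using laplace_ident_real(2)[OF pos[of n]] by (simp add: set_lebesgue_integral_def g_def)
      finally show ?thesis .
    qed
    show "summable (\<lambda>n. LINT k|lborel. norm (h n k))"
    proof (rule summable_comparison_test')
      show "summable (\<lambda>n. 2 * (1 / (t n)\<^sup>2))"
        unfolding t_def by (rule summable_mult[OF inverse_squares_scaled_summable])
      show "norm (LINT k|lborel. norm (h n k)) \<le> 2 * (1 / (t n)\<^sup>2)" for n
        using h_norm_le[of n] by (subst real_norm_def, subst abs_of_nonneg) (auto intro: integral_nonneg_AE)
    qed
  qed
  have "(\<Sum>n. h n k) = indicator {0<..} k *\<^sub>R (of_real (k / (exp (\<beta> * k) - 1)) * (cis (k * d) + cis (- k * d)))" for k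
  proof -
    have "(\<lambda>n. h n k) sums (of_real (indicator {0<..} k *\<^sub>R (k / (exp (\<beta> * k) - 1))) * (cis (k * d) + cis (- k * d)))"
      unfolding h_def by (intro sums_mult2 sums_of_real g_sums)
    then show ?thesis by (simp add: sums_iff indicator_def)
  qed
  then have lhs: "(LINT k|lborel. (\<Sum>n. h n k)) =
     (LINT k:{0<..}|lborel. of_real (k / (exp (\<beta> * k) - 1)) * (cis (k * d) + cis (- k * d)))"
    by (simp add: set_lebesgue_integral_def)
  \<comment> \<open>Factoring out \<beta> turns \<open>t n\<close> plus or minus i d into
    \<open>of_nat (Suc n)\<close> plus or minus \<open>z\<close>. Being imaginary and nonzero,
    \<open>z\<close> is no integer; the squares of \<open>z\<close> and of
    \<open>sin (of_real pi * z)\<close> are negative, which explains the signs of the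
    result.\<close>
  define z where "z = \<i> * of_real (d / \<beta>)"
  have "z \<notin> \<int>" using assms by (auto simp: z_def complex_is_Int_iff)
  note C = csc_squared_sums[OF this]
  have "integral\<^sup>L lborel (h n) = 1 / (of_real \<beta>)\<^sup>2 *
      (1 / (of_nat (Suc n) + z)\<^sup>2 + 1 / (of_nat (Suc n) - z)\<^sup>2)" for n
  proof -
    have eqs: "of_real (t n) - \<i> * of_real d = of_real \<beta> * (of_nat (Suc n) - z)"
         "of_real (t n) + \<i> * of_real d = of_real \<beta> * (of_nat (Suc n) + z)"
      using assms by (simp_all add: t_def z_def field_simps)
    show ?thesis unfolding h_val eqs power_mult_distrib
      by (subst add.commute) (simp add: distrib_left del: of_nat_Suc)
  qed
  then have "(\<lambda>n. integral\<^sup>L lborel (h n)) sums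
      (1 / (of_real \<beta>)\<^sup>2 * ((of_real pi / sin (of_real pi * z))\<^sup>2 - 1 / z\<^sup>2))"
    using sums_mult[OF C, of "1 / (of_real \<beta>)\<^sup>2"] by simp
  then have "(LINT k|lborel. (\<Sum>n. h n k)) =
      1 / (of_real \<beta>)\<^sup>2 * ((of_real pi / sin (of_real pi * z))\<^sup>2 - 1 / z\<^sup>2)"
    using int_sums sums_unique2 by blast
  also have "sin (of_real pi * z) = \<i> * of_real (sinh (pi * d / \<beta>))"
  proof -
    have "of_real pi * z = \<i> * of_real (pi * d / \<beta>)" by (simp add: z_def)
    then show ?thesis
      by (simp add: sin_exp_eq sinh_def scaleR_conv_of_real exp_of_real[symmetric] exp_minus field_simps)
  qed
  finally show ?thesis using assms unfolding lhs
    by (simp add: z_def power_mult_distrib power_divide field_simps)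
qed

text \<open>The phase has modulus 1, so integrability of the weight and of \<open>g\<close>
  separately gives joint integrability. Two weights are fed in: \<open>k\<close> times the
  occupation number, and \<open>k\<close> times the Abel factor.\<close>

lemma fubini_weighted_phase:
  fixes w :: "real \<Rightarrow> complex" and g :: "real \<times> real \<Rightarrow> complex" and \<theta> :: "real \<times> real \<Rightarrow> real"
  assumes w: "set_integrable lborel {0<..} w" and g: "integrable lborel g"
    and \<theta>[measurable]: "\<theta> \<in> borel_measurable borel"
  shows "(LINT k:{0<..}|lborel. w k * (LINT p|lborel. g p * cis (k * \<theta> p))) =
         (LINT p|lborel. g p * (LINT k:{0<..}|lborel. w k * cis (k * \<theta> p)))"
    and "integrable lborel (\<lambda>p. g p * (LINT k:{0<..}|lborel. w k * cis (k * \<theta> p)))"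
proof -
  define v where "v k = indicator {0<..} k *\<^sub>R w k" for k
  have v: "integrable lborel v" using w by (simp add: set_integrable_def v_def[abs_def])
  note [measurable] = borel_measurable_integrable[OF v] borel_measurable_integrable[OF g]
  define f where "f = (\<lambda>(k, p). v k * (g p * cis (k * \<theta> p)))"
  have f: "integrable (lborel \<Otimes>\<^sub>M lborel) f"
  proof (rule lborel_pair.Fubini_integrable)
    show "f \<in> borel_measurable (lborel \<Otimes>\<^sub>M lborel)"
      unfolding f_def by measurable
    have "integrable lborel (\<lambda>k. norm (v k) * (LINT p|lborel. norm (g p)))"
      using v by simp
    then show "integrable lborel (\<lambda>k. LINT p|lborel. norm (f (k, p)))"
      by (simp add: f_def norm_mult)
    have "integrable lborel (\<lambda>p. g p * cis (k * \<theta> p))" for k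
      by (rule Bochner_Integration.integrable_bound[OF g]) (auto simp: norm_mult)
    then show "AE k in lborel. integrable lborel (\<lambda>p. f (k, p))"
      by (simp add: f_def)
  qed
  have 1: "(LINT p|lborel. f (k, p)) = indicator {0<..} k *\<^sub>R (w k * (LINT p|lborel. g p * cis (k * \<theta> p)))" for k
    by (simp add: f_def v_def)
  have 2: "(LINT k|lborel. f (k, p)) = g p * (LINT k:{0<..}|lborel. w k * cis (k * \<theta> p))" for p
  proof -
    have "f (k, p) = g p * (indicator {0<..} k *\<^sub>R (w k * cis (k * \<theta> p)))" for k
      by (simp add: f_def v_def)
    then show ?thesis by (simp only: set_lebesgue_integral_def integral_mult_right_zero)
  qed
  show "(LINT k:{0<..}|lborel. w k * (LINT p|lborel. g p * cis (k * \<theta> p))) =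
         (LINT p|lborel. g p * (LINT k:{0<..}|lborel. w k * cis (k * \<theta> p)))"
    using lborel_pair.Fubini_integral[of "\<lambda>k p. f (k, p)"] f
    by (simp add: 1 2 set_lebesgue_integral_def)
  show "integrable lborel (\<lambda>p. g p * (LINT k:{0<..}|lborel. w k * cis (k * \<theta> p)))"
    using lborel_pair.integrable_snd[of "\<lambda>k p. f (k, p)"] f by (simp add: 2)
qed

text \<open>
  The left-hand side converges absolutely only because of the decay of the inner integral; the
  factor \<open>e\<^bsup>-\<eta>k\<^esup>\<close> makes Fubini applicable before \<open>\<eta> \<rightarrow> 0\<close>.
\<close>

lemma abel_summed_phase:
  fixes g :: "real \<times> real \<Rightarrow> complex" and \<theta> :: "real \<times> real \<Rightarrow> real"
  assumes g: "integrable lborel g"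
    and \<theta>[measurable]: "\<theta> \<in> borel_measurable borel"
    and \<delta>: "\<delta> > 0" "\<And>p. g p \<noteq> 0 \<Longrightarrow> \<delta> \<le> \<bar>\<theta> p\<bar>"
    and int: "set_integrable lborel {0<..} (\<lambda>k. of_real k * (LINT p|lborel. g p * cis (k * \<theta> p)))"
  shows "(LINT k:{0<..}|lborel. of_real k * (LINT p|lborel. g p * cis (k * \<theta> p))) =
         (LINT p|lborel. g p * of_real (- 1 / (\<theta> p)\<^sup>2))"
    and "integrable lborel (\<lambda>p. g p * of_real (- 1 / (\<theta> p)\<^sup>2))"
proof -
  note [measurable] = borel_measurable_integrable[OF g]
  define C where "C k = (LINT p|lborel. g p * cis (k * \<theta> p))" for k
  define \<eta> where "\<eta> n = 1 / real (Suc n)" for n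
  have \<eta>: "\<eta> n > 0" for n by (simp add: \<eta>_def)
  have \<eta>0: "\<eta> \<longlonglongrightarrow> 0" unfolding \<eta>_def[abs_def] by real_asymp
  have int': "integrable lborel (\<lambda>k. indicator {0<..} k *\<^sub>R (of_real k * C k))"
    using int by (simp add: C_def set_integrable_def)
  note [measurable] = borel_measurable_integrable[OF this]
  have eq: "(LINT k|lborel. exp (- \<eta> n * k) *\<^sub>R (indicator {0<..} k *\<^sub>R (of_real k * C k))) =
      (LINT p|lborel. g p * (1 / (of_real (\<eta> n) - \<i> * of_real (\<theta> p))\<^sup>2))" for n
  proof -
    have "set_integrable lborel {0<..} (\<lambda>k. of_real (k * exp (- \<eta> n * k)) :: complex)"
      using integrable_of_real[OF laplace_ident_real(1)[OF \<eta>[of n], unfolded set_integrable_def], where 'a = complex]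
      by (simp add: set_integrable_def scaleR_conv_of_real mult_ac)
    from fubini_weighted_phase(1)[OF this g \<theta>]
    have "(LINT k:{0<..}|lborel. of_real (k * exp (- \<eta> n * k)) * C k) =
      (LINT p|lborel. g p * (LINT k:{0<..}|lborel. of_real (k * exp (- \<eta> n * k)) * cis (k * \<theta> p)))"
      by (simp add: C_def)
    moreover have inner: "(LINT k:{0<..}|lborel. of_real (k * exp (- \<eta> n * k)) * cis (k * \<theta> p)) =
       1 / (of_real (\<eta> n) - \<i> * of_real (\<theta> p))\<^sup>2" for p
    proof -
      have "Re (of_real (\<eta> n) - \<i> * of_real (\<theta> p)) > 0" using \<eta> by simp
      note L = laplace_ident(2)[OF this]
      have "of_real (k * exp (- \<eta> n * k)) * cis (k * \<theta> p) =
        of_real k * exp (- (of_real (\<eta> n) - \<i> * of_real (\<theta> p)) * of_real k)" for k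
        by (auto simp: cis_conv_exp algebra_simps exp_of_real[symmetric] simp flip: exp_add)
      then show ?thesis using L by (simp only:)
    qed
    ultimately have "(LINT k:{0<..}|lborel. of_real (k * exp (- \<eta> n * k)) * C k) =
        (LINT p|lborel. g p * (1 / (of_real (\<eta> n) - \<i> * of_real (\<theta> p))\<^sup>2))"
      by (simp only: inner)
    moreover have "(LINT k:{0<..}|lborel. of_real (k * exp (- \<eta> n * k)) * C k) =
        (LINT k|lborel. exp (- \<eta> n * k) *\<^sub>R (indicator {0<..} k *\<^sub>R (of_real k * C k)))"
      unfolding set_lebesgue_integral_def
      by (rule Bochner_Integration.integral_cong) (auto simp: scaleR_conv_of_real indicator_def)
    ultimately show ?thesis by simp
  qed
  \<comment> \<open>Damping only shrinks the integrand on the positive axis, so the assumed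
    integrability of the undamped one is the majorant.\<close>
  have lim1: "(\<lambda>n. LINT k|lborel. exp (- \<eta> n * k) *\<^sub>R (indicator {0<..} k *\<^sub>R (of_real k * C k)))
      \<longlonglongrightarrow> (LINT k|lborel. indicator {0<..} k *\<^sub>R (of_real k * C k))"
  proof (rule integral_dominated_convergence)
    show "integrable lborel (\<lambda>k. norm (indicator {0<..} k *\<^sub>R (of_real k * C k)))"
      using int' by (rule integrable_norm)
    show "AE k in lborel. (\<lambda>n. exp (- \<eta> n * k) *\<^sub>R (indicator {0<..} k *\<^sub>R (of_real k * C k)))
        \<longlonglongrightarrow> indicator {0<..} k *\<^sub>R (of_real k * C k)"
    proof (rule AE_I2)
      fix k
      have "(\<lambda>n. exp (- \<eta> n * k)) \<longlonglongrightarrow> exp (- 0 * k)"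
        by (intro tendsto_intros \<eta>0)
      then have "(\<lambda>n. exp (- \<eta> n * k) *\<^sub>R (indicator {0<..} k *\<^sub>R (of_real k * C k)))
        \<longlonglongrightarrow> exp (- 0 * k) *\<^sub>R (indicator {0<..} k *\<^sub>R (of_real k * C k))"
        by (intro tendsto_scaleR tendsto_const)
      then show "(\<lambda>n. exp (- \<eta> n * k) *\<^sub>R (indicator {0<..} k *\<^sub>R (of_real k * C k)))
        \<longlonglongrightarrow> indicator {0<..} k *\<^sub>R (of_real k * C k)" by simp
    qed
    show "AE k in lborel. norm (exp (- \<eta> n * k) *\<^sub>R (indicator {0<..} k *\<^sub>R (of_real k * C k)))
        \<le> norm (indicator {0<..} k *\<^sub>R (of_real k * C k))" for n
      using \<eta>[of n] by (auto simp: indicator_def intro!: mult_left_le_one_le)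
  qed measurable
  \<comment> \<open>Where \<open>g\<close> does not vanish, the modulus of \<eta> - i \<theta> is at
    least that of \<theta>, hence at least \<delta>. This majorant does not depend on the regulator;
    it is what the gap \<delta> is for.\<close>
  have bound: "norm (g p * (1 / (of_real (\<eta> n) - \<i> * of_real (\<theta> p))\<^sup>2)) \<le> norm (g p) * (1 / \<delta>\<^sup>2)" for n p
  proof (cases "g p = 0")
    case False
    have "\<delta> \<le> norm (of_real (\<eta> n) - \<i> * of_real (\<theta> p))"
      using \<delta>(2)[OF False] abs_Im_le_cmod[of "of_real (\<eta> n) - \<i> * of_real (\<theta> p)"] by simp
    then have "\<delta>\<^sup>2 \<le> (norm (of_real (\<eta> n) - \<i> * of_real (\<theta> p)))\<^sup>2"
      using \<delta>(1) by (intro power_mono) auto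
    then have "1 / (norm (of_real (\<eta> n) - \<i> * of_real (\<theta> p)))\<^sup>2 \<le> 1 / \<delta>\<^sup>2"
      using \<delta>(1) by (intro divide_left_mono mult_pos_pos) (auto intro: less_le_trans[of 0 "\<delta>\<^sup>2"])
    then have "norm (g p) * (1 / (norm (of_real (\<eta> n) - \<i> * of_real (\<theta> p)))\<^sup>2) \<le> norm (g p) * (1 / \<delta>\<^sup>2)"
      by (intro mult_left_mono) auto
    then show ?thesis by (simp add: norm_mult norm_divide norm_power)
  qed simp
  have ptw: "(\<lambda>n. g p * (1 / (of_real (\<eta> n) - \<i> * of_real (\<theta> p))\<^sup>2)) \<longlonglongrightarrow> g p * of_real (- 1 / (\<theta> p)\<^sup>2)" for p
  proof (cases "g p = 0")
    case False
    then have t: "\<theta> p \<noteq> 0" using \<delta>(1) \<delta>(2)[OF False] by auto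
    have "(\<lambda>n. g p * (1 / (of_real (\<eta> n) - \<i> * of_real (\<theta> p))\<^sup>2)) \<longlonglongrightarrow>
       g p * (1 / (of_real 0 - \<i> * of_real (\<theta> p))\<^sup>2)"
      by (intro tendsto_intros \<eta>0) (use t in auto)
    then show ?thesis by (simp add: power_mult_distrib)
  qed simp
  have dom: "integrable lborel (\<lambda>p. norm (g p) * (1 / \<delta>\<^sup>2))" using g by simp
  have lim2: "(\<lambda>n. LINT p|lborel. g p * (1 / (of_real (\<eta> n) - \<i> * of_real (\<theta> p))\<^sup>2)) \<longlonglongrightarrow>
      (LINT p|lborel. g p * of_real (- 1 / (\<theta> p)\<^sup>2))"
    by (rule integral_dominated_convergence[OF _ _ dom]) (use bound ptw in \<open>auto simp del: of_real_divide\<close>)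
  show "integrable lborel (\<lambda>p. g p * of_real (- 1 / (\<theta> p)\<^sup>2))"
    by (rule integrable_dominated_convergence[where s = "\<lambda>n p. g p * (1 / (of_real (\<eta> n) - \<i> * of_real (\<theta> p))\<^sup>2)", OF _ _ dom])
      (use bound ptw in \<open>auto simp del: of_real_divide\<close>)
  show "(LINT k:{0<..}|lborel. of_real k * (LINT p|lborel. g p * cis (k * \<theta> p))) =
         (LINT p|lborel. g p * of_real (- 1 / (\<theta> p)\<^sup>2))"
    using LIMSEQ_unique[OF lim1[unfolded eq] lim2] by (simp add: set_lebesgue_integral_def C_def)
qed

section \<open>Smooth bumps and uniqueness of kernels\<close>

text \<open>For \<open>n = 0\<close> the classical smooth function that is flat at 0. The powers in
  the denominator make the family closed, up to linear combinations, under differentiation.\<close>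

definition flat :: "nat \<Rightarrow> real \<Rightarrow> real" where
  "flat n t = (if t > 0 then exp (- 1 / t) / t ^ n else 0)"

lemma flat_tendsto_0: "(flat n \<longlongrightarrow> 0) (at 0)"
proof -
  have "((\<lambda>t. (1 / t) ^ n / exp (1 / t)) \<longlongrightarrow> 0) (at_right (0::real))"
    using tendsto_power_div_exp_0[of n] filterlim_inverse_at_top_right
    by (auto intro: filterlim_compose simp: inverse_eq_divide)
  then have "(flat n \<longlongrightarrow> 0) (at_right 0)"
    by (rule Lim_transform_eventually)
       (auto simp: flat_def eventually_at_filter exp_minus power_divide power_inverse divide_inverse mult_ac)
  moreover have "(flat n \<longlongrightarrow> 0) (at_left 0)"
    by (rule Lim_transform_eventually[OF tendsto_const]) (auto simp: flat_def eventually_at_filter)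
  ultimately show ?thesis by (simp add: filterlim_split_at)
qed

lemma flat_has_derivative:
  "(flat n has_real_derivative flat (n + 2) t - real n * flat (n + 1) t) (at t)"
proof -
  consider "t > 0" | "t < 0" | "t = 0" by linarith
  then show ?thesis
  proof cases
    case 1
    have "((\<lambda>t. exp (- 1 / t) / t ^ n) has_real_derivative
        flat (n + 2) t - real n * flat (n + 1) t) (at t)"
    proof (cases n)
      case 0
      then show ?thesis using 1
        by (auto intro!: derivative_eq_intros simp: flat_def field_simps power2_eq_square)
    next
      case (Suc m)
      then show ?thesis using 1
        by (auto intro!: derivative_eq_intros simp: flat_def field_simps power2_eq_square)
          (metis One_nat_def power_eq_if)
    qed
    then show ?thesis
      by (rule has_field_derivative_transform_within_open[of _ _ _ "{0<..}"]) (use 1 in \<open>auto simp: flat_def\<close>)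
  next
    case 2
    have "((\<lambda>_. 0) has_real_derivative 0) (at t)" by simp
    then have "(flat n has_real_derivative 0) (at t)"
      by (rule has_field_derivative_transform_within_open[of _ _ _ "{..<0}"]) (use 2 in \<open>auto simp: flat_def\<close>)
    then show ?thesis using 2 by (simp add: flat_def)
  next
    case 3
    \<comment> \<open>At 0 the difference quotient of one member is the next member, so
      differentiability there is \<open>flat_tendsto_0\<close> one index higher.\<close>
    have eq: "flat (n + 1) = (\<lambda>h. (flat n h - flat n 0) / (h - 0))"
      by (auto simp: flat_def)
    have "(flat n has_real_derivative 0) (at 0)"
      using flat_tendsto_0[of "n + 1"] unfolding has_field_derivative_iff eq .
    then show ?thesis using 3 by (simp add: flat_def)
  qed
qed

text \<open>Being closed under differentiation, this set consists of smooth functions.\<close>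

inductive_set flat_algebra :: "(real \<Rightarrow> real) set" where
  left: "(\<lambda>t. flat n (t - c)) \<in> flat_algebra"
| right: "(\<lambda>t. flat n (c - t)) \<in> flat_algebra"
| add: "f \<in> flat_algebra \<Longrightarrow> g \<in> flat_algebra \<Longrightarrow> (\<lambda>t. f t + g t) \<in> flat_algebra"
| scale: "f \<in> flat_algebra \<Longrightarrow> (\<lambda>t. c * f t) \<in> flat_algebra"
| mult: "f \<in> flat_algebra \<Longrightarrow> g \<in> flat_algebra \<Longrightarrow> (\<lambda>t. f t * g t) \<in> flat_algebra"

lemma flat_algebra_closed_derivative:
  "f \<in> flat_algebra \<Longrightarrow> \<exists>f'\<in>flat_algebra. \<forall>t. (f has_real_derivative f' t) (at t)"
proof (induction rule: flat_algebra.induct)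
  case (left n c)
  let ?f' = "\<lambda>t. flat (n + 2) (t - c) + (- real n) * flat (n + 1) (t - c)"
  have "?f' \<in> flat_algebra" by (intro flat_algebra.intros)
  moreover have "((\<lambda>t. flat n (t - c)) has_real_derivative ?f' t) (at t)" for t
  proof -
    have "((\<lambda>t. t - c) has_real_derivative 1) (at t)" by (auto intro!: derivative_eq_intros)
    from DERIV_chain2[where f = "flat n", OF flat_has_derivative this] show ?thesis by simp
  qed
  ultimately show ?case by (intro bexI[of _ ?f']) auto
next
  case (right n c)
  let ?f' = "\<lambda>t. (- 1) * flat (n + 2) (c - t) + real n * flat (n + 1) (c - t)"
  have "?f' \<in> flat_algebra" by (intro flat_algebra.intros)
  moreover have "((\<lambda>t. flat n (c - t)) has_real_derivative ?f' t) (at t)" for t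
  proof -
    have "((\<lambda>t. c - t) has_real_derivative - 1) (at t)" by (auto intro!: derivative_eq_intros)
    from DERIV_chain2[where f = "flat n", OF flat_has_derivative this] show ?thesis by simp
  qed
  ultimately show ?case by (intro bexI[of _ ?f']) auto
next
  case (add f g)
  then obtain f' g' where "f' \<in> flat_algebra" "g' \<in> flat_algebra"
    "\<And>t. (f has_real_derivative f' t) (at t)" "\<And>t. (g has_real_derivative g' t) (at t)" by blast
  then show ?case
    by (intro bexI[of _ "\<lambda>t. f' t + g' t"]) (auto intro!: derivative_intros flat_algebra.intros)
next
  case (scale f c)
  then obtain f' where "f' \<in> flat_algebra" "\<And>t. (f has_real_derivative f' t) (at t)" by blast
  then show ?case
    by (intro bexI[of _ "\<lambda>t. c * f' t"]) (auto intro!: DERIV_cmult flat_algebra.intros)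
next
  case (mult f g)
  then obtain f' g' where "f' \<in> flat_algebra" "g' \<in> flat_algebra"
    "\<And>t. (f has_real_derivative f' t) (at t)" "\<And>t. (g has_real_derivative g' t) (at t)" by blast
  with mult.hyps show ?case
    by (intro bexI[of _ "\<lambda>t. f' t * g t + g' t * f t"]) (auto intro!: DERIV_mult flat_algebra.intros)
qed

text \<open>\<open>test_function\<close> asks for one sequence containing all derivatives, so the
  existence of a derivative inside the algebra is iterated by dependent choice.\<close>

lemma flat_algebra_smooth:
  assumes "f \<in> flat_algebra"
  shows "\<exists>D. D 0 = (\<lambda>t. complex_of_real (f t)) \<and>
    (\<forall>n t. (D n has_vector_derivative D (Suc n) t) (at t))"
proof -
  have "\<exists>D. \<forall>n. (D n \<in> flat_algebra \<and> (n = 0 \<longrightarrow> D n = f)) \<and>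
      (\<forall>t. (D n has_real_derivative D (Suc n) t) (at t))"
    by (rule dependent_nat_choice) (use assms flat_algebra_closed_derivative in \<open>auto simp: Bex_def\<close>)
  then obtain D where D: "D 0 = f" "\<And>n t. (D n has_real_derivative D (Suc n) t) (at t)" by blast
  have "((\<lambda>t. complex_of_real (D n t)) has_vector_derivative complex_of_real (D (Suc n) t)) (at t)" for n t
    using D(2)[of n t] bounded_linear.has_vector_derivative[OF bounded_linear_of_real]
    by (simp add: has_real_derivative_iff_has_vector_derivative)
  then show ?thesis using D(1) by (intro exI[of _ "\<lambda>n t. of_real (D n t)"]) auto
qed

definition bump :: "real \<Rightarrow> real \<Rightarrow> real \<Rightarrow> real" where
  "bump c d t = flat 0 (t - c) * flat 0 (d - t)"

lemma bump_nonneg: "bump c d t \<ge> 0"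
  by (simp add: bump_def flat_def)

lemma bump_pos_iff: "bump c d t > 0 \<longleftrightarrow> c < t \<and> t < d"
  by (auto simp: bump_def flat_def)

lemma support_bump: "support (\<lambda>t. complex_of_real (bump c d t)) \<subseteq> {c..d}"
  unfolding support_def
  by (rule closure_minimal) (auto simp: bump_def flat_def split: if_splits)

lemma test_function_bump: "test_function (\<lambda>t. complex_of_real (bump c d t))"
proof -
  have "bump c d \<in> flat_algebra"
    unfolding bump_def[abs_def] by (intro flat_algebra.intros)
  moreover have "compact (support (\<lambda>t. complex_of_real (bump c d t)))"
    using support_bump[of c d] compact_Icc closed_closure unfolding support_def
    by (metis compact_Int_closed inf.absorb_iff2)
  ultimately show ?thesis
    using flat_algebra_smooth unfolding test_function_def by blast
qed

text \<open>\<open>W\<close> may blow up at the diagonal. Disjoint supports keep the compact product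
  of the supports away from it, so the integrand is continuous on a compact set and vanishes
  outside.\<close>

lemma kernel_integrand_integrable:
  assumes F: "continuous_on UNIV F" "compact (support F)"
    and G: "continuous_on UNIV G" "compact (support G)"
    and disj: "support F \<inter> support G = {}"
    and W: "continuous_on {p. fst p \<noteq> snd p} (\<lambda>p. W (fst p) (snd p))"
  shows "integrable lborel (\<lambda>p. F (fst p) * G (snd p) * W (fst p) (snd p) :: complex)"
proof -
  let ?K = "support F \<times> support G"
  let ?f = "\<lambda>p. F (fst p) * G (snd p) * W (fst p) (snd p)"
  have "compact ?K" using F G by (intro compact_Times)
  moreover have "continuous_on ?K ?f"
  proof (intro continuous_intros)
    show "continuous_on ?K (\<lambda>p. F (fst p))" "continuous_on ?K (\<lambda>p. G (snd p))"
      by (auto intro!: continuous_on_compose2[OF F(1)] continuous_on_compose2[OF G(1)] continuous_intros)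
    show "continuous_on ?K (\<lambda>p. W (fst p) (snd p))"
      using disj by (intro continuous_on_subset[OF W]) auto
  qed
  ultimately have "integrable lborel (\<lambda>p. indicator ?K p *\<^sub>R ?f p)"
    by (rule borel_integrable_compact)
  moreover have "indicator ?K p *\<^sub>R ?f p = ?f p" for p
    using closure_subset[of "{x. F x \<noteq> 0}"] closure_subset[of "{x. G x \<noteq> 0}"]
    by (cases p) (auto simp: support_def indicator_def)
  ultimately show ?thesis by simp
qed

lemma test_function_continuous:
  assumes "test_function F" shows "continuous_on UNIV F"
proof -
  obtain D where "D 0 = F" "\<And>n t. (D n has_vector_derivative D (Suc n) t) (at t)"
    using assms by (auto simp: test_function_def)
  then have "\<And>t. (F has_vector_derivative D 1 t) (at t)" by (metis One_nat_def)
  then show ?thesis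
    by (meson continuous_at_imp_continuous_on has_vector_derivative_continuous)
qed

text \<open>The fundamental lemma of the calculus of variations, with products of bumps as test
  functions. They live on small rectangles off the diagonal, where the defining condition applies
  and continuity fixes the values.\<close>

lemma two_point_kernel_unique:
  assumes W1: "two_point_kernel ip a b E X W1" and W2: "two_point_kernel ip a b E X W2"
    and "y \<noteq> y'"
  shows "W1 y y' = W2 y y'"
proof (rule ccontr)
  assume neq: "W1 y y' \<noteq> W2 y y'"
  define w where "w = W1 y y' - W2 y y'"
  \<comment> \<open>A complex difference has no sign. Multiplying by the conjugate of its value at
    the point in question gives a real part that is positive there, hence nearby.\<close>
  define h where "h p = Re (cnj w * (W1 (fst p) (snd p) - W2 (fst p) (snd p)))" for p
  let ?U = "{p :: real \<times> real. fst p \<noteq> snd p}"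
  have c1: "continuous_on ?U (\<lambda>p. W1 (fst p) (snd p))" and c2: "continuous_on ?U (\<lambda>p. W2 (fst p) (snd p))"
    using W1 W2 by (auto simp: two_point_kernel_def)
  have ch: "continuous_on ?U h" unfolding h_def by (intro continuous_intros c1 c2)
  have opU: "open ?U" by (intro open_Collect_neq continuous_intros)
  have "h (y, y') = (cmod w)\<^sup>2"
    unfolding h_def fst_conv snd_conv w_def[symmetric] by (subst cmod_power2) (simp add: power2_eq_square)
  then have hpos: "h (y, y') > 0" using neq by (simp add: w_def)
  have "open (?U \<inter> h -` {0<..})" using ch opU by (intro continuous_open_preimage) auto
  then obtain e where e: "e > 0" "ball (y, y') e \<subseteq> ?U \<inter> h -` {0<..}"
    using hpos assms(3) unfolding open_contains_ball by fastforce
  \<comment> \<open>Half-sides \<open>r / 2\<close> keep the closed rectangle within distance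
    \<open>r < e\<close> of its centre, so inside a ball off the diagonal. In particular the two
    intervals that span it, and with them the supports, cannot meet.\<close>
  define r where "r = e / 2"
  have r: "r > 0" "r < e" using e by (auto simp: r_def)
  let ?B = "{y - r / 2..y + r / 2} \<times> {y' - r / 2..y' + r / 2}"
  have B: "p \<in> ?U \<and> h p > 0" if "p \<in> ?B" for p
  proof -
    have "dist (y, y') p < e"
    proof -
      have "dist (y, y') p \<le> \<bar>y - fst p\<bar> + \<bar>y' - snd p\<bar>"
        using sqrt_sum_squares_le_sum_abs[of "y - fst p" "y' - snd p"]
        by (cases p) (simp add: dist_Pair_Pair dist_real_def)
      also have "\<dots> \<le> r / 2 + r / 2" using that by (cases p) (auto intro!: add_mono simp: abs_le_iff)
      finally show ?thesis using r by simp
    qed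
    then show ?thesis using e(2) by auto
  qed
  define F where "F t = complex_of_real (bump (y - r / 2) (y + r / 2) t)" for t
  define G where "G t = complex_of_real (bump (y' - r / 2) (y' + r / 2) t)" for t
  have tF: "test_function F" and tG: "test_function G"
    unfolding F_def[abs_def] G_def[abs_def] by (rule test_function_bump)+
  have sF: "support F \<subseteq> {y - r / 2..y + r / 2}" and sG: "support G \<subseteq> {y' - r / 2..y' + r / 2}"
    unfolding F_def[abs_def] G_def[abs_def] by (rule support_bump)+
  have disj: "support F \<inter> support G = {}"
  proof (rule equals0I)
    fix t assume "t \<in> support F \<inter> support G"
    then have "(t, t) \<in> ?B" using sF sG by blast
    from B[OF this] show False by simp
  qed
  have int: "integrable lborel (\<lambda>p. F (fst p) * G (snd p) * W (fst p) (snd p))"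
    if "continuous_on ?U (\<lambda>p. W (fst p) (snd p))" for W
    using tF tG disj that
    by (intro kernel_integrand_integrable test_function_continuous) (auto simp: test_function_def)
  have "E (adj ip (deriv_field ip a b X (\<lambda>y. cnj (F y))) \<circ> deriv_field ip a b X G) =
      (LINT p|lborel. F (fst p) * G (snd p) * W (fst p) (snd p))"
    if "two_point_kernel ip a b E X W" for W
    using that tF tG disj unfolding two_point_kernel_def by blast
  from this[OF W1] this[OF W2]
  have "(LINT p|lborel. F (fst p) * G (snd p) * W1 (fst p) (snd p)) =
        (LINT p|lborel. F (fst p) * G (snd p) * W2 (fst p) (snd p))"
    by (rule trans[OF sym])
  then have "(LINT p|lborel. F (fst p) * G (snd p) * W1 (fst p) (snd p) -
        F (fst p) * G (snd p) * W2 (fst p) (snd p)) = 0"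
    using int[OF c1] int[OF c2] by simp
  moreover define f where "f = (\<lambda>p. F (fst p) * G (snd p) * W1 (fst p) (snd p) -
        F (fst p) * G (snd p) * W2 (fst p) (snd p))"
  ultimately have f0: "integral\<^sup>L lborel f = 0" by (simp only: f_def)
  have fi: "integrable lborel f" unfolding f_def using int[OF c1] int[OF c2] by simp
  have f_eq: "Re (cnj w * f p) = bump (y - r / 2) (y + r / 2) (fst p) * bump (y' - r / 2) (y' + r / 2) (snd p) * h p" for p
    unfolding f_def h_def F_def G_def by (simp add: algebra_simps)
  have "integral\<^sup>L lborel (\<lambda>p. Re (cnj w * f p)) = Re (integral\<^sup>L lborel (\<lambda>p. cnj w * f p))"
    using fi by (intro integral_Re) simp
  also have "\<dots> = 0" using f0 by simp
  finally have z: "integral\<^sup>L lborel (\<lambda>p. Re (cnj w * f p)) = 0" .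
  have nn: "Re (cnj w * f p) \<ge> 0" for p
  proof (cases "p \<in> ?B")
    case True
    then show ?thesis using B[OF True] bump_nonneg unfolding f_eq by (simp only: zero_le_mult_iff less_imp_le simp_thms)
  next
    case False
    then have "bump (y - r / 2) (y + r / 2) (fst p) = 0 \<or> bump (y' - r / 2) (y' + r / 2) (snd p) = 0"
      by (cases p) (auto simp: bump_def flat_def)
    then show ?thesis unfolding f_eq by auto
  qed
  \<comment> \<open>A nonnegative function with integral 0 vanishes almost everywhere, yet this one
    is positive on a nonempty open rectangle, which is not negligible.\<close>
  have "AE p in lborel. Re (cnj w * f p) = 0"
    using z nn fi by (subst (asm) integral_nonneg_eq_0_iff_AE) auto
  then obtain N where N: "{p. Re (cnj w * f p) \<noteq> 0} \<subseteq> N" "N \<in> null_sets lborel"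
    by (auto elim!: AE_E simp: null_sets_def)
  let ?O = "{y - r / 2<..<y + r / 2} \<times> {y' - r / 2<..<y' + r / 2}"
  have "?O \<subseteq> N"
  proof
    fix p assume p: "p \<in> ?O"
    then have "p \<in> ?B" by auto
    with p have "Re (cnj w * f p) > 0"
      using B unfolding f_eq by (intro mult_pos_pos) (auto simp: bump_pos_iff)
    then show "p \<in> N" using N by auto
  qed
  moreover have "negligible N"
    using N(2) null_sets_completionI by (auto simp: negligible_iff_null_sets)
  ultimately have "negligible ?O" using negligible_subset by blast
  moreover have "open ?O" by (intro open_Times open_greaterThanLessThan)
  moreover have "(y, y') \<in> ?O" using r by simp
  ultimately show False using open_not_negligible by blast
qed

text \<open>Turns the definite description into a computed value as soon as one kernel is
  exhibited.\<close>

lemma two_point_eq: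
  assumes "two_point_kernel ip a b E X W" "y \<noteq> y'"
  shows "two_point ip a b E X y y' = W y y'"
  unfolding two_point_def
  using assms two_point_kernel_unique by (intro the_equality) blast+

section \<open>Mode coefficients of test functions\<close>

lemma integrable_compact_support:
  fixes h :: "real \<Rightarrow> 'a::euclidean_space"
  assumes "continuous_on UNIV h" "compact K" "\<And>y. y \<notin> K \<Longrightarrow> h y = 0"
  shows "integrable lborel h"
proof -
  have "integrable lborel (\<lambda>y. indicator K y *\<^sub>R h y)"
    using continuous_on_subset[OF assms(1) subset_UNIV] by (intro borel_integrable_compact assms(2))
  moreover have "indicator K y *\<^sub>R h y = h y" for y
    using assms(3)[of y] by (auto simp: indicator_def)
  ultimately show ?thesis by simp
qed

lemma integral_derivative_compact_support:
  fixes H :: "real \<Rightarrow> 'a::euclidean_space"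
  assumes H: "\<And>y. (H has_vector_derivative h y) (at y)" and h: "continuous_on UNIV h"
    and K: "compact K" "\<And>y. y \<notin> K \<Longrightarrow> H y = 0" "\<And>y. y \<notin> K \<Longrightarrow> h y = 0"
  shows "(LINT y|lborel. h y) = 0"
proof -
  obtain r where r: "\<And>y. y \<in> K \<Longrightarrow> norm y \<le> r"
    using compact_imp_bounded[OF K(1)] by (auto simp: bounded_iff)
  define R where "R = \<bar>r\<bar> + 1"
  have R: "y \<notin> K" if "\<bar>y\<bar> \<ge> R" for y using r[of y] that by (auto simp: R_def)
  have "R > 0" by (simp add: R_def)
  have "(LINT y|lborel. indicator {-R..R} y *\<^sub>R h y) = H R - H (- R)"
    using \<open>R > 0\<close> H h
    by (intro integral_FTC_atLeastAtMost) (auto intro: has_vector_derivative_at_within continuous_on_subset)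
  also have "\<dots> = 0" using K(2) R[of R] R[of "- R"] \<open>R > 0\<close> by simp
  finally have "(LINT y|lborel. indicator {-R..R} y *\<^sub>R h y) = 0" .
  moreover have "indicator {-R..R} y *\<^sub>R h y = h y" for y
    using K(3)[OF R, of y] by (auto simp: indicator_def abs_le_iff)
  ultimately show ?thesis by simp
qed

lemma integral_product_lborel:
  fixes u v :: "real \<Rightarrow> complex"
  assumes u: "integrable lborel u" and v: "integrable lborel v"
  shows "integrable lborel (\<lambda>p. u (fst p) * v (snd p))"
    and "(LINT p|lborel. u (fst p) * v (snd p)) = (LINT y|lborel. u y) * (LINT y|lborel. v y)"
proof -
  note [measurable] = borel_measurable_integrable[OF u] borel_measurable_integrable[OF v]
  let ?f = "\<lambda>p. u (fst p) * v (snd p)"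
  have f: "integrable (lborel \<Otimes>\<^sub>M lborel) ?f"
  proof (rule lborel_pair.Fubini_integrable)
    have "integrable lborel (\<lambda>x. norm (u x) * (LINT y|lborel. norm (v y)))"
      using u by simp
    then show "integrable lborel (\<lambda>x. LINT y|lborel. norm (?f (x, y)))"
      by (simp add: norm_mult)
  qed (use v in \<open>simp_all\<close>)
  then show "integrable lborel ?f" by (simp add: lborel_prod)
  show "(LINT p|lborel. ?f p) = (LINT y|lborel. u y) * (LINT y|lborel. v y)"
    using lborel_pair.integral_fst'[OF f] by (simp add: lborel_prod)
qed

lemma inverse_one_plus_square_integrable: "set_integrable lborel {0<..} (\<lambda>k::real. 1 / (1 + k\<^sup>2))"
proof -
  have E: "einterval 0 \<infinity> = {0<..}"
    by (simp add: einterval_eq_Ici zero_ereal_def)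
  have "((arctan \<circ> real_of_ereal) \<longlongrightarrow> arctan 0) (at_right 0)"
    unfolding zero_ereal_def ereal_tendsto_simps by (intro tendsto_intros)
  moreover have "((arctan \<circ> real_of_ereal) \<longlongrightarrow> pi / 2) (at_left \<infinity>)"
    unfolding ereal_tendsto_simps by (rule tendsto_arctan_at_top)
  moreover have "(arctan has_real_derivative 1 / (1 + k\<^sup>2)) (at k)" for k
    by (auto intro!: derivative_eq_intros simp: field_simps)
  moreover have "isCont (\<lambda>k::real. 1 / (1 + k\<^sup>2)) k" for k
    by (intro continuous_intros) (simp add: add_nonneg_eq_0_iff)
  ultimately show ?thesis
    unfolding E[symmetric] by (intro interval_integral_FTC_nonneg(1)[of 0 \<infinity> arctan]) auto
qed

text \<open>Vanishing like \<open>k\<close> at 0 tames the infrared weight \<open>1 / k^2\<close>,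
  and decay like \<open>1 / k\<close> gives square integrability at infinity. The factor 4 lets one
  majorant cover both ranges: it bounds \<open>(k / 2 + 1) * (1 + k^2)\<close> below 1 and
  \<open>2 * (1 + k^2) / k^2\<close> above.\<close>

lemma mode_functions_bounded_decay:
  assumes f: "f \<in> borel_measurable borel"
    and C: "\<And>k. norm (f k) \<le> C * \<bar>k\<bar>" "\<And>k. \<bar>k\<bar> * norm (f k) \<le> C"
  shows "f \<in> mode_functions"
proof -
  have "C \<ge> 0" using C(2)[of 0] by simp
  have le: "(norm (f k))\<^sup>2 * (1 / (2 * k) + 1 / k\<^sup>2) \<le> 4 * C\<^sup>2 * (1 / (1 + k\<^sup>2))" if k: "k > 0" for k
  proof (cases "k \<le> 1")
    case True
    have "(norm (f k))\<^sup>2 * (1 / (2 * k) + 1 / k\<^sup>2) \<le> (C * k)\<^sup>2 * (1 / (2 * k) + 1 / k\<^sup>2)"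
      using C(1)[of k] k by (intro mult_right_mono power_mono) auto
    also have "\<dots> = C\<^sup>2 * (k / 2 + 1)" using k by (simp add: field_simps power2_eq_square)
    also have "\<dots> \<le> C\<^sup>2 * (4 * (1 / (1 + k\<^sup>2)))"
    proof (intro mult_left_mono)
      have "k\<^sup>2 \<le> 1" using True k by (simp add: power_le_one)
      then have "(k / 2 + 1) * (1 + k\<^sup>2) \<le> 2 * 2" using True k by (intro mult_mono) auto
      moreover have "1 + k\<^sup>2 > 0" by (simp add: add_pos_nonneg)
      ultimately show "k / 2 + 1 \<le> 4 * (1 / (1 + k\<^sup>2))"
        by (simp add: pos_le_divide_eq)
    qed simp
    finally show ?thesis by (simp only: mult_ac)
  next
    case False
    have "norm (f k) \<le> C / k" using C(2)[of k] k by (simp add: field_simps)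
    then have "(norm (f k))\<^sup>2 * (1 / (2 * k) + 1 / k\<^sup>2) \<le> (C / k)\<^sup>2 * (1 / (2 * k) + 1 / k\<^sup>2)"
      using k by (intro mult_right_mono power_mono) auto
    also have "\<dots> \<le> (C / k)\<^sup>2 * 2"
    proof (intro mult_left_mono)
      have "1 / (2 * k) \<le> 1" "1 / k\<^sup>2 \<le> 1" using False by (auto simp: field_simps)
      then show "1 / (2 * k) + 1 / k\<^sup>2 \<le> 2" by simp
    qed simp
    also have "\<dots> = C\<^sup>2 * (2 / k\<^sup>2)" by (simp add: power_divide)
    also have "\<dots> \<le> C\<^sup>2 * (4 * (1 / (1 + k\<^sup>2)))"
    proof (intro mult_left_mono)
      have "1 \<le> k\<^sup>2" using False by simp
      moreover have "1 + k\<^sup>2 > 0" by (simp add: add_pos_nonneg)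
      ultimately show "2 / k\<^sup>2 \<le> 4 * (1 / (1 + k\<^sup>2))" using k by (simp add: field_simps)
    qed simp
    finally show ?thesis by (simp only: mult_ac)
  qed
  have "set_integrable lborel {0<..} (\<lambda>k. (norm (f k))\<^sup>2 * (1 / (2 * k) + 1 / k\<^sup>2))"
    unfolding set_integrable_def
  proof (rule Bochner_Integration.integrable_bound)
    show "integrable lborel (\<lambda>k. 4 * C\<^sup>2 * (indicator {0<..} k *\<^sub>R (1 / (1 + k\<^sup>2))))"
      using inverse_one_plus_square_integrable unfolding set_integrable_def by (intro integrable_mult_right)
    show "AE k in lborel. norm (indicator {0<..} k *\<^sub>R ((norm (f k))\<^sup>2 * (1 / (2 * k) + 1 / k\<^sup>2)))
        \<le> norm (4 * C\<^sup>2 * (indicator {0<..} k *\<^sub>R (1 / (1 + k\<^sup>2))))"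
    proof (rule AE_I2)
      fix k :: real
      show "norm (indicator {0<..} k *\<^sub>R ((norm (f k))\<^sup>2 * (1 / (2 * k) + 1 / k\<^sup>2)))
        \<le> norm (4 * C\<^sup>2 * (indicator {0<..} k *\<^sub>R (1 / (1 + k\<^sup>2))))"
      proof (cases "k > 0")
        case True
        have "0 \<le> (norm (f k))\<^sup>2 * (1 / (2 * k) + 1 / k\<^sup>2)" using True by simp
        moreover have "0 \<le> 4 * C\<^sup>2 * (1 / (1 + k\<^sup>2))" by simp
        ultimately show ?thesis
          using le[OF True] True
          by (simp only: indicator_simps greaterThan_iff scaleR_one real_norm_def abs_of_nonneg)
      qed simp
    qed
  qed (use f in measurable)
  then show ?thesis using f by (simp add: mode_functions_def)
qed

lemma mode_functions_product_integrable:
  assumes f: "f \<in> mode_functions" and g: "g \<in> mode_functions"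
  shows "set_integrable lborel {0<..} (\<lambda>k. f k * g k / of_real (2 * k))"
proof -
  have [measurable]: "f \<in> borel_measurable borel" "g \<in> borel_measurable borel"
    using f g by (auto simp: mode_functions_def)
  have "integrable lborel (\<lambda>k. indicator {0<..} k *\<^sub>R ((norm (f k))\<^sup>2 * (1 / (2 * k) + 1 / k\<^sup>2))
     + indicator {0<..} k *\<^sub>R ((norm (g k))\<^sup>2 * (1 / (2 * k) + 1 / k\<^sup>2)))"
    using f g by (intro Bochner_Integration.integrable_add) (auto simp: mode_functions_def set_integrable_def)
  then show ?thesis unfolding set_integrable_def
  proof (rule Bochner_Integration.integrable_bound)
    show "AE k in lborel. norm (indicator {0<..} k *\<^sub>R (f k * g k / of_real (2 * k))) \<le>
       norm (indicator {0<..} k *\<^sub>R ((norm (f k))\<^sup>2 * (1 / (2 * k) + 1 / k\<^sup>2))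
     + indicator {0<..} k *\<^sub>R ((norm (g k))\<^sup>2 * (1 / (2 * k) + 1 / k\<^sup>2)))"
    proof (rule AE_I2)
      fix k :: real
      show "norm (indicator {0<..} k *\<^sub>R (f k * g k / of_real (2 * k))) \<le>
       norm (indicator {0<..} k *\<^sub>R ((norm (f k))\<^sup>2 * (1 / (2 * k) + 1 / k\<^sup>2))
     + indicator {0<..} k *\<^sub>R ((norm (g k))\<^sup>2 * (1 / (2 * k) + 1 / k\<^sup>2)))"
      proof (cases "k > 0")
        case True
        have "norm (f k) * norm (g k) \<le> (norm (f k))\<^sup>2 + (norm (g k))\<^sup>2"
        proof -
          have "0 \<le> norm (f k) * norm (g k)" by simp
          then show ?thesis
            using sum_squares_bound[of "norm (f k)" "norm (g k)"] by linarith
        qed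
        then have "norm (f k) * norm (g k) * (1 / (2 * k)) \<le>
            ((norm (f k))\<^sup>2 + (norm (g k))\<^sup>2) * (1 / (2 * k))"
          using True by (intro mult_right_mono) auto
        also have "\<dots> \<le> ((norm (f k))\<^sup>2 + (norm (g k))\<^sup>2) * (1 / (2 * k) + 1 / k\<^sup>2)"
          by (intro mult_left_mono) auto
        finally have "norm (f k * g k / of_real (2 * k)) \<le>
            (norm (f k))\<^sup>2 * (1 / (2 * k) + 1 / k\<^sup>2) + (norm (g k))\<^sup>2 * (1 / (2 * k) + 1 / k\<^sup>2)"
          using True by (simp only: norm_mult norm_divide distrib_right) (simp add: norm_mult)
        then show ?thesis using True by (simp only: indicator_simps greaterThan_iff scaleR_one real_norm_def)
      qed simp
    qed
  qed measurable
qed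

lemma test_function_derivatives:
  assumes "test_function F"
  obtains F1 F2 K where "compact K"
    "\<And>y. (F has_vector_derivative F1 y) (at y)" "\<And>y. (F1 has_vector_derivative F2 y) (at y)"
    "continuous_on UNIV F" "continuous_on UNIV F1" "continuous_on UNIV F2"
    "\<And>y. y \<notin> K \<Longrightarrow> F y = 0" "\<And>y. y \<notin> K \<Longrightarrow> F1 y = 0" "\<And>y. y \<notin> K \<Longrightarrow> F2 y = 0"
proof -
  obtain D where D: "D 0 = F" "\<And>n y. (D n has_vector_derivative D (Suc n) y) (at y)"
    and K: "compact (support F)"
    using assms by (auto simp: test_function_def)
  have c: "continuous_on UNIV (D n)" for n
    using D(2)[of n] by (meson continuous_at_imp_continuous_on has_vector_derivative_continuous)
  have z: "D n y = 0" if "y \<notin> support F" for n y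
    using that
  proof (induction n arbitrary: y)
    case 0
    then show ?case using closure_subset[of "{x. F x \<noteq> 0}"] by (auto simp: D support_def)
  next
    case (Suc n)
    have "((\<lambda>_. 0) has_vector_derivative D (Suc n) y) (at y)"
      by (rule has_vector_derivative_transform_within_open[OF D(2)[of n], of "- support F"])
         (use Suc K in \<open>auto simp: support_def\<close>)
    from vector_derivative_unique_at[OF this has_vector_derivative_const] show ?case .
  qed
  show ?thesis
  proof (rule that[of "support F" "D 1" "D 2"])
    show "(F has_vector_derivative D 1 y) (at y)" "(D 1 has_vector_derivative D 2 y) (at y)" for y
      using D(2)[of 0 y] D(2)[of 1 y] by (simp_all add: D(1) numeral_2_eq_2)
    show "continuous_on UNIV F" using c[of 0] by (simp add: D(1))
    show "F y = 0" if "y \<notin> support F" for y using z[of y 0] that by (simp add: D(1))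
  qed (use K c z in auto)
qed

text \<open>Two continuous derivatives are what two integrations by parts ask of the change of
  coordinates; a third one enters later, as a hypothesis of the point-splitting limit. Positivity of
  \<open>X1\<close> permits division by it and makes \<open>X\<close> injective, so that kernels are
  singular on the diagonal alone.\<close>

locale coordinate =
  fixes X X1 X2 :: "real \<Rightarrow> real"
  assumes X: "\<And>y. (X has_real_derivative X1 y) (at y)"
    and X1: "\<And>y. (X1 has_real_derivative X2 y) (at y)"
    and X2: "continuous_on UNIV X2"
    and X1_pos: "\<And>y. X1 y > 0"
begin

lemma strict_mono_X: "strict_mono X"
proof (rule strict_monoI)
  fix x y :: real
  assume "x < y"
  then show "X x < X y"
    by (rule DERIV_pos_imp_increasing) (use X X1_pos in blast)
qed

lemma X_eq_iff: "X y = X y' \<longleftrightarrow> y = y'"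
  by (rule strict_mono_eq[OF strict_mono_X])

lemma continuous_X: "continuous_on S X" and continuous_X1: "continuous_on S X1"
  by (auto intro!: continuous_at_imp_continuous_on DERIV_isCont X X1)

lemma phase_derivative:
  "((\<lambda>y. cis (c * X y)) has_vector_derivative (\<i> * of_real (c * X1 y)) * cis (c * X y)) (at y)"
proof -
  have "((\<lambda>y. exp (\<i> * of_real (c * X y))) has_vector_derivative
      (\<i> * of_real (c * X1 y)) * exp (\<i> * of_real (c * X y))) (at y)"
  proof -
    have "((\<lambda>y. c * X y) has_vector_derivative c * X1 y) (at y)"
      using X[of y] by (auto intro!: derivative_eq_intros simp: has_real_derivative_iff_has_vector_derivative[symmetric])
    then have "((\<lambda>y. \<i> * complex_of_real (c * X y)) has_vector_derivative \<i> * of_real (c * X1 y)) (at y)"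
      using bounded_linear.has_vector_derivative[OF bounded_linear_of_real]
      by (intro has_vector_derivative_mult_right) (auto simp del: of_real_mult)
    from field_vector_diff_chain_at[OF this, of exp "exp (\<i> * of_real (c * X y))"]
    show ?thesis by (simp add: o_def DERIV_exp)
  qed
  then show ?thesis by (simp add: cis_conv_exp)
qed

text \<open>Used in both directions: with \<open>H\<close> the test function it extracts a factor
  \<open>k\<close>, with \<open>H\<close> its derivative divided by \<open>X1\<close> it gains decay
  \<open>1 / k\<close>.\<close>

lemma phase_by_parts:
  fixes H h :: "real \<Rightarrow> complex"
  assumes H: "\<And>y. (H has_vector_derivative h y) (at y)" and h: "continuous_on UNIV h"
    and K: "compact K" "\<And>y. y \<notin> K \<Longrightarrow> H y = 0" "\<And>y. y \<notin> K \<Longrightarrow> h y = 0"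
  shows "(LINT y|lborel. h y * cis (c * X y)) = - \<i> * of_real c * (LINT y|lborel. H y * of_real (X1 y) * cis (c * X y))"
proof -
  have cH: "continuous_on UNIV H"
    using H by (meson continuous_at_imp_continuous_on has_vector_derivative_continuous)
  have cc: "continuous_on UNIV (\<lambda>y. cis (c * X y))"
    by (intro continuous_intros continuous_X)
  have c1: "continuous_on UNIV (\<lambda>y. h y * cis (c * X y))"
    by (intro continuous_intros h cc)
  have c2: "continuous_on UNIV (\<lambda>y. H y * of_real (X1 y) * cis (c * X y))"
    by (intro continuous_intros cH cc continuous_X1)
  have i1: "integrable lborel (\<lambda>y. h y * cis (c * X y))"
    by (rule integrable_compact_support[OF c1 K(1)]) (use K in auto)
  have i2: "integrable lborel (\<lambda>y. H y * of_real (X1 y) * cis (c * X y))"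
    by (rule integrable_compact_support[OF c2 K(1)]) (use K in auto)
  have "(LINT y|lborel. h y * cis (c * X y) + \<i> * of_real c * (H y * of_real (X1 y) * cis (c * X y))) = 0"
  proof (rule integral_derivative_compact_support[OF _ _ K(1)])
    show "((\<lambda>y. H y * cis (c * X y)) has_vector_derivative
        h y * cis (c * X y) + \<i> * of_real c * (H y * of_real (X1 y) * cis (c * X y))) (at y)" for y
      using has_vector_derivative_mult[OF H[of y] phase_derivative[of c y]]
      by (simp add: algebra_simps)
    show "continuous_on UNIV (\<lambda>y. h y * cis (c * X y) + \<i> * of_real c * (H y * of_real (X1 y) * cis (c * X y)))"
      by (intro continuous_on_add c1 continuous_on_mult_left c2)
  qed (use K in auto)
  then show ?thesis using i1 i2 by (simp add: add_eq_0_iff2)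
qed

text \<open>At positive \<open>k\<close> this is the coefficient of the annihilator in the smeared
  derivative field, at \<open>- k\<close> that of the creator.\<close>

definition deriv_coeff :: "(real \<Rightarrow> complex) \<Rightarrow> real \<Rightarrow> complex" where
  "deriv_coeff F = mode_coeff X (\<lambda>y. - vector_derivative F (at y))"

lemma deriv_coeff_eq:
  assumes "test_function F"
  shows "deriv_coeff F k = - \<i> * of_real k / of_real (sqrt (2 * pi)) *
    (LINT y|lborel. F y * of_real (X1 y) * cis (- k * X y))"
proof -
  obtain F1 F2 K where F: "compact K"
    "\<And>y. (F has_vector_derivative F1 y) (at y)" "continuous_on UNIV F1"
    "\<And>y. y \<notin> K \<Longrightarrow> F y = 0" "\<And>y. y \<notin> K \<Longrightarrow> F1 y = 0"
    using test_function_derivatives[OF assms] by metis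
  have "vector_derivative F (at y) = F1 y" for y using F(2) vector_derivative_at by blast
  then show ?thesis
    using phase_by_parts[OF F(2,3,1,4,5), of "- k"] by (simp add: deriv_coeff_def mode_coeff_def)
qed

text \<open>One integration by parts puts the derivative on the phase and shows vanishing like
  \<open>k\<close> at 0, which removes the infrared divergence of the massless field. A second one
  in the opposite direction gives the decay at infinity.\<close>

lemma deriv_coeff_bound:
  assumes "test_function F"
  shows "\<exists>C. \<forall>k. norm (deriv_coeff F k) \<le> C * \<bar>k\<bar> \<and> \<bar>k\<bar> * norm (deriv_coeff F k) \<le> C"
proof -
  obtain F1 F2 K where F: "compact K"
    "\<And>y. (F has_vector_derivative F1 y) (at y)" "\<And>y. (F1 has_vector_derivative F2 y) (at y)"
    "continuous_on UNIV F" "continuous_on UNIV F1" "continuous_on UNIV F2"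
    "\<And>y. y \<notin> K \<Longrightarrow> F y = 0" "\<And>y. y \<notin> K \<Longrightarrow> F1 y = 0" "\<And>y. y \<notin> K \<Longrightarrow> F2 y = 0"
    by (rule test_function_derivatives[OF assms]) (rule that)
  have X10: "X1 y \<noteq> 0" for y using X1_pos[of y] by simp
  \<comment> \<open>Dividing by \<open>X1\<close> compensates the factor \<open>X1\<close> from the
    derivative of the phase, so that \<open>phase_by_parts\<close> returns the integral of
    \<open>F1\<close> itself.\<close>
  define H where "H y = F1 y / of_real (X1 y)" for y
  define h where "h y = F2 y / of_real (X1 y) - F1 y * of_real (X2 y) / (of_real (X1 y))\<^sup>2" for y
  have H: "(H has_vector_derivative h y) (at y)" for y
  proof -
    have "((\<lambda>y. 1 / X1 y) has_real_derivative - X2 y / (X1 y)\<^sup>2) (at y)"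
      using X1[of y] X10[of y] by (auto intro!: derivative_eq_intros simp: power2_eq_square)
    then have "((\<lambda>y. complex_of_real (1 / X1 y)) has_vector_derivative of_real (- X2 y / (X1 y)\<^sup>2)) (at y)"
      using bounded_linear.has_vector_derivative[OF bounded_linear_of_real]
      unfolding has_real_derivative_iff_has_vector_derivative by blast
    from has_vector_derivative_mult[OF F(3)[of y] this]
    show ?thesis unfolding H_def[abs_def] h_def by (simp add: algebra_simps)
  qed
  have ch: "continuous_on UNIV h"
    unfolding h_def[abs_def] by (intro continuous_intros F continuous_X1 X2) (auto simp: X10)
  have K: "H y = 0" "h y = 0" if "y \<notin> K" for y using F that by (auto simp: H_def h_def)
  let ?s = "sqrt (2 * pi)"
  have s: "?s > 0" by simp
  have vd: "vector_derivative F (at y) = F1 y" for y using F(2) vector_derivative_at by blast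
  have second: "of_real k * deriv_coeff F k = (LINT y|lborel. h y * cis (- k * X y)) * (\<i> / of_real ?s)" for k
  proof -
    have "(LINT y|lborel. h y * cis (- k * X y)) = \<i> * of_real k * (LINT y|lborel. F1 y * cis (- k * X y))"
      using phase_by_parts[OF H ch F(1) K, of "- k"] X10 by (simp add: H_def)
    then have "(LINT y|lborel. h y * cis (- k * X y)) * (\<i> / of_real ?s) =
        - (of_real k * (LINT y|lborel. F1 y * cis (- k * X y)) / of_real ?s)"
      by (simp add: field_simps)
    then show ?thesis by (simp add: deriv_coeff_def mode_coeff_def vd)
  qed
  define A where "A = (LINT y|lborel. norm (F y * of_real (X1 y))) / ?s"
  define B where "B = (LINT y|lborel. norm (h y)) / ?s"
  have AB: "A \<ge> 0" "B \<ge> 0" by (auto simp: A_def B_def)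
  have "norm (deriv_coeff F k) \<le> A * \<bar>k\<bar>" for k
  proof -
    have "norm (LINT y|lborel. F y * of_real (X1 y) * cis (- k * X y)) \<le> (LINT y|lborel. norm (F y * of_real (X1 y) * cis (- k * X y)))"
      by (rule integral_norm_bound)
    also have "\<dots> = A * ?s" by (simp add: A_def norm_mult)
    finally have "norm (LINT y|lborel. F y * of_real (X1 y) * cis (- k * X y)) \<le> A * ?s" .
    then have "\<bar>k\<bar> / ?s * norm (LINT y|lborel. F y * of_real (X1 y) * cis (- k * X y)) \<le> \<bar>k\<bar> / ?s * (A * ?s)"
      by (intro mult_left_mono) auto
    then show ?thesis using s
      by (simp add: deriv_coeff_eq[OF assms] norm_mult norm_divide mult.commute)
  qed
  moreover have "\<bar>k\<bar> * norm (deriv_coeff F k) \<le> B" for k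
  proof -
    have "norm (LINT y|lborel. h y * cis (- k * X y)) \<le> (LINT y|lborel. norm (h y * cis (- k * X y)))"
      by (rule integral_norm_bound)
    also have "\<dots> = B * ?s" by (simp add: B_def norm_mult)
    finally have "norm (LINT y|lborel. h y * cis (- k * X y)) * (1 / ?s) \<le> B * ?s * (1 / ?s)"
      by (intro mult_right_mono) auto
    moreover have "norm (of_real k * deriv_coeff F k) = norm (LINT y|lborel. h y * cis (- k * X y)) * (1 / ?s)"
      unfolding second by (simp add: norm_mult norm_divide)
    ultimately show ?thesis using s by (simp add: norm_mult)
  qed
  moreover have "A * \<bar>k\<bar> \<le> (A + B) * \<bar>k\<bar>" for k
    using AB by (intro mult_right_mono) auto
  moreover have "B \<le> A + B" using AB by simp
  ultimately have "norm (deriv_coeff F k) \<le> (A + B) * \<bar>k\<bar> \<and> \<bar>k\<bar> * norm (deriv_coeff F k) \<le> A + B" for k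
    by (meson order_trans)
  then show ?thesis by blast
qed

lemma deriv_coeff_measurable [measurable]:
  assumes "test_function F"
  shows "deriv_coeff F \<in> borel_measurable borel"
proof -
  obtain F1 F2 K where F: "\<And>y. (F has_vector_derivative F1 y) (at y)" "continuous_on UNIV F1"
    using test_function_derivatives[OF assms] by metis
  have vd: "vector_derivative F (at y) = F1 y" for y using F(1) vector_derivative_at by blast
  have [measurable]: "F1 \<in> borel_measurable borel" "X \<in> borel_measurable borel"
    using F(2) continuous_X by (auto intro: borel_measurable_continuous_onI)
  show ?thesis
    unfolding deriv_coeff_def mode_coeff_def[abs_def] vd by measurable
qed

lemma deriv_coeff_mode_functions:
  assumes "test_function F"
  shows "deriv_coeff F \<in> mode_functions" "(\<lambda>k. deriv_coeff F (- k)) \<in> mode_functions"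
proof -
  obtain C where C: "norm (deriv_coeff F k) \<le> C * \<bar>k\<bar>" "\<bar>k\<bar> * norm (deriv_coeff F k) \<le> C" for k
    using deriv_coeff_bound[OF assms] by blast
  note [measurable] = deriv_coeff_measurable[OF assms]
  show "deriv_coeff F \<in> mode_functions"
    using C by (intro mode_functions_bounded_decay[of _ C]) auto
  show "(\<lambda>k. deriv_coeff F (- k)) \<in> mode_functions"
    using C[of "- _"] by (intro mode_functions_bounded_decay[of _ C]) auto
qed

text \<open>Conjugating a phase reverses the sign of \<open>k\<close>, so a conjugated test function
  exchanges annihilation and creation coefficients, up to conjugation.\<close>

lemma deriv_coeff_cnj:
  assumes "test_function F"
  shows "deriv_coeff (\<lambda>y. cnj (F y)) k = cnj (deriv_coeff F (- k))"
proof -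
  obtain F1 F2 K where F: "\<And>y. (F has_vector_derivative F1 y) (at y)"
    using test_function_derivatives[OF assms] by metis
  have "((\<lambda>y. cnj (F y)) has_vector_derivative cnj (F1 y)) (at y)" for y
    using F by (rule has_vector_derivative_cnj)
  then have "vector_derivative (\<lambda>y. cnj (F y)) (at y) = cnj (vector_derivative F (at y))" for y
    using F vector_derivative_at by metis
  then have eq: "- vector_derivative (\<lambda>y. cnj (F y)) (at y) * cis (- k * X y) =
      cnj (- vector_derivative F (at y) * cis (- (- k) * X y))" for y
    by (simp add: cis_cnj)
  show ?thesis
    unfolding deriv_coeff_def mode_coeff_def eq Bochner_Integration.integral_cnj by simp
qed

end

section \<open>From mode integrals to the kernel in position space\<close>

lemma set_integrable_phase:
  fixes w :: "real \<Rightarrow> complex" and t :: real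
  assumes "set_integrable lborel {0<..} w"
  shows "set_integrable lborel {0<..} (\<lambda>k. w k * cis (k * t))"
proof -
  have i: "integrable lborel (\<lambda>k. indicator {0<..} k *\<^sub>R w k)"
    using assms by (simp add: set_integrable_def)
  have "integrable lborel (\<lambda>k. (indicator {0<..} k *\<^sub>R w k) * cis (k * t))"
  proof (rule Bochner_Integration.integrable_bound[OF i])
    note [measurable] = borel_measurable_integrable[OF i]
    show "(\<lambda>k. (indicator {0<..} k *\<^sub>R w k) * cis (k * t)) \<in> borel_measurable lborel"
      by measurable
  qed (simp add: norm_mult)
  then show ?thesis by (simp add: set_integrable_def)
qed

text \<open>\<theta> has no zero on the compact product of the supports, so its modulus has a
  positive minimum there: the gap that \<open>abel_summed_phase\<close> asks for.\<close>

lemma separated_supports_gap: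
  fixes \<theta> :: "real \<times> real \<Rightarrow> real"
  assumes "compact (support F)" "compact (support G)" "support F \<inter> support G = {}"
    and "continuous_on UNIV \<theta>" "\<And>y y'. \<theta> (y, y') = 0 \<Longrightarrow> y = y'"
  obtains \<delta> where "\<delta> > 0" "\<And>p. F (fst p) \<noteq> 0 \<Longrightarrow> G (snd p) \<noteq> 0 \<Longrightarrow> \<delta> \<le> \<bar>\<theta> p\<bar>"
proof -
  let ?K = "support F \<times> support G"
  have K: "p \<in> ?K" if "F (fst p) \<noteq> 0" "G (snd p) \<noteq> 0" for p
    using that closure_subset[of "{x. F x \<noteq> 0}"] closure_subset[of "{x. G x \<noteq> 0}"]
    by (cases p) (auto simp: support_def)
  show ?thesis
  proof (cases "?K = {}")
    case True
    then show ?thesis using that[of 1] K by auto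
  next
    case False
    have "compact ?K" using assms by (intro compact_Times)
    moreover have "continuous_on ?K (\<lambda>p. \<bar>\<theta> p\<bar>)"
      by (intro continuous_intros continuous_on_subset[OF assms(4) subset_UNIV])
    ultimately obtain q where q: "q \<in> ?K" "\<And>p. p \<in> ?K \<Longrightarrow> \<bar>\<theta> q\<bar> \<le> \<bar>\<theta> p\<bar>"
      using continuous_attains_inf[of ?K] False by blast
    have "\<theta> q \<noteq> 0" using q(1) assms(3,5) by (cases q) auto
    then show ?thesis using that[of "\<bar>\<theta> q\<bar>"] K q by auto
  qed
qed

context coordinate
begin

text \<open>The prefactors of the two coefficients multiply to \<open>k^2 / (2 * pi)\<close>.
  Divided by the \<open>2 * k\<close> of the mode measure this leaves the weight
  \<open>k / (4 * pi)\<close>, the origin of the \<open>4 * pi\<close> in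
  \<open>kernel\<close>.\<close>

lemma deriv_coeff_product:
  assumes F: "test_function F" and G: "test_function G"
  defines "g \<equiv> \<lambda>p. F (fst p) * of_real (X1 (fst p)) * (G (snd p) * of_real (X1 (snd p)))"
  shows "integrable lborel g"
    and "deriv_coeff F (- k) * deriv_coeff G k =
      of_real (k\<^sup>2 / (2 * pi)) * (LINT p|lborel. g p * cis (k * (X (fst p) - X (snd p))))"
proof -
  have int: "integrable lborel (\<lambda>y. H y * of_real (X1 y) * cis (c * X y))" if H: "test_function H" for H c
  proof -
    obtain H1 H2 K where K: "compact K" "continuous_on UNIV H" "\<And>y. y \<notin> K \<Longrightarrow> H y = 0"
      using test_function_derivatives[OF H] by metis
    show ?thesis
      by (rule integrable_compact_support[OF _ K(1)])
         (use K in \<open>auto intro!: continuous_intros continuous_X continuous_X1\<close>)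
  qed
  show "integrable lborel g"
    unfolding g_def using integral_product_lborel(1)[OF int[OF F, of 0] int[OF G, of 0]] by simp
  have c: "cis (k * (X (fst p) - X (snd p))) = cis (k * X (fst p)) * cis (- k * X (snd p))" for p
    by (simp add: cis_mult right_diff_distrib)
  have g: "(F (fst p) * of_real (X1 (fst p)) * cis (k * X (fst p))) *
      (G (snd p) * of_real (X1 (snd p)) * cis (- k * X (snd p))) =
      g p * cis (k * (X (fst p) - X (snd p)))" for p
    unfolding c by (simp add: g_def)
  have "(LINT y|lborel. F y * of_real (X1 y) * cis (k * X y)) *
      (LINT y|lborel. G y * of_real (X1 y) * cis (- k * X y)) =
      (LINT p|lborel. g p * cis (k * (X (fst p) - X (snd p))))"
    using integral_product_lborel(2)[OF int[OF F, of k] int[OF G, of "- k"]] by (simp only: g)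
  moreover have "complex_of_real (sqrt (2 * pi)) * of_real (sqrt (2 * pi)) = of_real (2 * pi)"
    unfolding of_real_mult[symmetric] by simp
  ultimately show "deriv_coeff F (- k) * deriv_coeff G k =
      of_real (k\<^sup>2 / (2 * pi)) * (LINT p|lborel. g p * cis (k * (X (fst p) - X (snd p))))"
    unfolding deriv_coeff_eq[OF F] deriv_coeff_eq[OF G]
    by (simp add: power2_eq_square field_simps)
qed

text \<open>
  \<open>\<nu>\<close> is the occupation number, \<open>0\<close> for the vacuum.  On the diagonal the value is junk.
\<close>

definition kernel :: "(real \<Rightarrow> real) \<Rightarrow> real \<Rightarrow> real \<Rightarrow> complex" where
  "kernel \<nu> y y' = of_real (X1 y * X1 y' / (4 * pi)) *
     ((LINT k:{0<..}|lborel. of_real (k * \<nu> k) * (cis (k * (X y - X y')) + cis (- k * (X y - X y'))))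
       - of_real (1 / (X y - X y')\<^sup>2))"

text \<open>The integrals are the mean of a normal-ordered product and, for the product in the
  opposite order, the commutator followed by its normal-ordered mean. The two with \<nu> have an
  absolutely integrable weight and go by Fubini; the middle one needs Abel summation.\<close>

lemma mode_sum_eq_kernel:
  assumes F: "test_function F" and G: "test_function G" and disj: "support F \<inter> support G = {}"
    and \<nu>: "set_integrable lborel {0<..} (\<lambda>k. k * \<nu> k)"
  shows "(LINT k:{0<..}|lborel. deriv_coeff F (- k) * deriv_coeff G k * of_real (\<nu> k) / of_real (2 * k))
     + ((LINT k:{0<..}|lborel. deriv_coeff F k * deriv_coeff G (- k) / of_real (2 * k))
     + (LINT k:{0<..}|lborel. deriv_coeff F k * deriv_coeff G (- k) * of_real (\<nu> k) / of_real (2 * k)))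
     = (LINT p|lborel. F (fst p) * G (snd p) * kernel \<nu> (fst p) (snd p))"
proof -
  define g where "g = (\<lambda>p. F (fst p) * of_real (X1 (fst p)) * (G (snd p) * of_real (X1 (snd p))))"
  define \<theta> where "\<theta> = (\<lambda>p. X (fst p) - X (snd p))"
  define w where "w = (\<lambda>k. complex_of_real (k * \<nu> k))"
  let ?C = "\<lambda>t k. LINT p|lborel. g p * cis (k * t p)"
  let ?\<theta>' = "\<lambda>p. - \<theta> p"
  have g: "integrable lborel g"
    unfolding g_def by (rule deriv_coeff_product(1)[OF F G])
  have prod1: "deriv_coeff F (- k) * deriv_coeff G k = of_real (k\<^sup>2 / (2 * pi)) * ?C \<theta> k" for k
    unfolding g_def \<theta>_def by (rule deriv_coeff_product(2)[OF F G])
  \<comment> \<open>Replacing \<open>k\<close> by \<open>- k\<close> leaves \<open>k^2\<close> alone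
    and reverses the phase, recorded as a change of sign of \<theta>.\<close>
  have prod2: "deriv_coeff F k * deriv_coeff G (- k) = of_real (k\<^sup>2 / (2 * pi)) * ?C ?\<theta>' k" for k
    using prod1[of "- k"] by simp
  have c\<theta>: "continuous_on UNIV \<theta>"
    unfolding \<theta>_def by (auto intro!: continuous_intros continuous_on_compose2[OF continuous_X])
  then have [measurable]: "\<theta> \<in> borel_measurable borel" "?\<theta>' \<in> borel_measurable borel"
    by (auto intro!: borel_measurable_continuous_onI continuous_intros)
  have w: "set_integrable lborel {0<..} w"
    using \<nu> integrable_of_real[of lborel "\<lambda>k. indicator {0<..} k *\<^sub>R (k * \<nu> k)", where 'a = complex]
    by (simp add: set_integrable_def w_def scaleR_conv_of_real)
  have quarter: "of_real (k\<^sup>2 / (2 * pi)) * c / of_real (2 * k) = of_real k * c / of_real (4 * pi)"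
    if "k > 0" for k :: real and c :: complex
    using that by (simp add: field_simps power2_eq_square)
  have T1: "(LINT k:{0<..}|lborel. deriv_coeff F (- k) * deriv_coeff G k * of_real (\<nu> k) / of_real (2 * k))
      = (LINT k:{0<..}|lborel. w k * ?C \<theta> k) / of_real (4 * pi)"
  proof -
    have "deriv_coeff F (- k) * deriv_coeff G k * of_real (\<nu> k) / of_real (2 * k) =
        w k * ?C \<theta> k / of_real (4 * pi)" if "k > 0" for k
      using quarter[OF that, of "?C \<theta> k * of_real (\<nu> k)"] unfolding prod1 w_def by (simp add: mult_ac)
    then show ?thesis
      by (subst set_integral_divide_zero[symmetric]) (intro set_lebesgue_integral_cong, auto)
  qed
  have T3: "(LINT k:{0<..}|lborel. deriv_coeff F k * deriv_coeff G (- k) * of_real (\<nu> k) / of_real (2 * k))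
      = (LINT k:{0<..}|lborel. w k * ?C ?\<theta>' k) / of_real (4 * pi)"
  proof -
    have "deriv_coeff F k * deriv_coeff G (- k) * of_real (\<nu> k) / of_real (2 * k) =
        w k * ?C ?\<theta>' k / of_real (4 * pi)" if "k > 0" for k
      using quarter[OF that, of "?C ?\<theta>' k * of_real (\<nu> k)"] unfolding prod2 w_def by (simp add: mult_ac)
    then show ?thesis
      by (subst set_integral_divide_zero[symmetric]) (intro set_lebesgue_integral_cong, auto)
  qed
  have eq2: "deriv_coeff F k * deriv_coeff G (- k) / of_real (2 * k) =
      of_real k * ?C ?\<theta>' k / of_real (4 * pi)" if "k > 0" for k
    using quarter[OF that, of "?C ?\<theta>' k"] unfolding prod2 by simp
  then have T2: "(LINT k:{0<..}|lborel. deriv_coeff F k * deriv_coeff G (- k) / of_real (2 * k))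
      = (LINT k:{0<..}|lborel. of_real k * ?C ?\<theta>' k) / of_real (4 * pi)"
    by (subst set_integral_divide_zero[symmetric]) (intro set_lebesgue_integral_cong, auto)
  \<comment> \<open>This premise of Abel summation comes from the decay of the coefficients at both
    ends; the weight \<open>k\<close> alone would not give it.\<close>
  have int2: "set_integrable lborel {0<..} (\<lambda>k. of_real k * ?C ?\<theta>' k)"
  proof -
    have "set_integrable lborel {0<..} (\<lambda>k. of_real (4 * pi) * (deriv_coeff F k * deriv_coeff G (- k) / of_real (2 * k)))"
      by (intro set_integrable_mult_right mode_functions_product_integrable deriv_coeff_mode_functions F G)
    then show ?thesis
      by (rule set_integrable_cong[THEN iffD1, rotated -1]) (use eq2 in auto)
  qed
  obtain \<delta> where \<delta>: "\<delta> > 0" "\<And>p. F (fst p) \<noteq> 0 \<Longrightarrow> G (snd p) \<noteq> 0 \<Longrightarrow> \<delta> \<le> \<bar>\<theta> p\<bar>"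
    by (rule separated_supports_gap[of F G \<theta>])
       (use F G disj c\<theta> X_eq_iff in \<open>auto simp: test_function_def \<theta>_def\<close>)
  have \<delta>': "\<delta> \<le> \<bar>?\<theta>' p\<bar>" if "g p \<noteq> 0" for p using that \<delta>(2)[of p] by (auto simp: g_def)
  note A = abel_summed_phase[OF g _ \<delta>(1) \<delta>' int2]
  note F1 = fubini_weighted_phase[OF w g, of \<theta>] and F3 = fubini_weighted_phase[OF w g, of ?\<theta>']
  have "(LINT k:{0<..}|lborel. w k * ?C \<theta> k) +
      ((LINT k:{0<..}|lborel. of_real k * ?C ?\<theta>' k) + (LINT k:{0<..}|lborel. w k * ?C ?\<theta>' k)) =
     (LINT p|lborel. g p * (LINT k:{0<..}|lborel. w k * cis (k * \<theta> p)) +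
       (g p * of_real (- 1 / (?\<theta>' p)\<^sup>2) + g p * (LINT k:{0<..}|lborel. w k * cis (k * ?\<theta>' p))))"
    using F1 F3 A by simp
  also have "\<dots> = (LINT p|lborel. of_real (4 * pi) * (F (fst p) * G (snd p) * kernel \<nu> (fst p) (snd p)))"
  proof (intro Bochner_Integration.integral_cong refl)
    fix p :: "real \<times> real"
    define I1 where "I1 = (LINT k:{0<..}|lborel. w k * cis (k * \<theta> p))"
    define I3 where "I3 = (LINT k:{0<..}|lborel. w k * cis (k * ?\<theta>' p))"
    have "(LINT k:{0<..}|lborel. w k * (cis (k * \<theta> p) + cis (- k * \<theta> p))) = I1 + I3"
      using set_integral_add(2)[OF set_integrable_phase[OF w, of "\<theta> p"] set_integrable_phase[OF w, of "- \<theta> p"]]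
      by (simp add: distrib_left I1_def I3_def)
    then have "kernel \<nu> (fst p) (snd p) = of_real (X1 (fst p) * X1 (snd p) / (4 * pi)) * (I1 + I3 - of_real (1 / (\<theta> p)\<^sup>2))"
      by (simp only: kernel_def w_def \<theta>_def)
    moreover have "of_real (4 * pi) * (F (fst p) * G (snd p) * (of_real (X1 (fst p) * X1 (snd p) / (4 * pi)) * c)) = g p * c" for c
      by (simp add: g_def)
    ultimately show "g p * I1 + (g p * of_real (- 1 / (?\<theta>' p)\<^sup>2) + g p * I3) =
       of_real (4 * pi) * (F (fst p) * G (snd p) * kernel \<nu> (fst p) (snd p))"
      by (simp only:) (simp add: algebra_simps)
  qed
  finally show ?thesis unfolding T1 T2 T3
    by (simp add: add_divide_distrib[symmetric])
qed

end

section \<open>Means of products of field operators\<close>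

lemma mode_functions_cnj:
  assumes "f \<in> mode_functions"
  shows "(\<lambda>k. cnj (f k)) \<in> mode_functions"
proof -
  have "f \<in> borel_measurable borel" using assms by (simp add: mode_functions_def)
  then have "(\<lambda>k. cnj (f k)) \<in> borel_measurable borel"
    by (rule borel_measurable_continuous_on[OF continuous_on_cnj[OF continuous_on_id]])
  then show ?thesis using assms by (simp add: mode_functions_def)
qed

context pre_hilbert
begin

lemma ip_zero_right: "ip u 0 = 0"
  using ip_add_right[of u 0 0] by simp

lemma ip_zero_left: "ip 0 u = 0"
  using ip_commute[of 0 u] ip_zero_right by simp

lemma ip_add_left: "ip (u + v) w = ip u w + ip v w"
  using ip_commute[of "u + v" w] ip_commute[of u w] ip_commute[of v w] ip_add_right
  by (metis complex_cnj_add complex_cnj_cnj)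

lemma ip_left_cancel:
  assumes "\<And>w. ip u w = ip v w"
  shows "u = v"
proof -
  have "ip (u - v) w = 0" for w
    using ip_add_left[of "u - v" v w] assms[of w] by simp
  then show ?thesis using ip_definite[of "u - v"] by simp
qed

lemma adj_eq:
  assumes "is_adjoint ip A B"
  shows "adj ip A = B"
  unfolding adj_def
proof (rule the_equality)
  show "is_adjoint ip A B" by fact
  fix C assume "is_adjoint ip A C"
  then show "C = B"
    using assms by (intro ext ip_left_cancel) (simp add: is_adjoint_def)
qed

lemma is_adjoint_sym:
  assumes "is_adjoint ip A B"
  shows "is_adjoint ip B A"
  using assms ip_commute unfolding is_adjoint_def by metis

lemma is_adjoint_add:
  assumes "is_adjoint ip A B" "is_adjoint ip A' B'"
  shows "is_adjoint ip (\<lambda>u. A u + A' u) (\<lambda>u. B u + B' u)"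
  using assms by (simp add: is_adjoint_def ip_add_left ip_add_right)

lemma is_adjoint_additive:
  assumes "is_adjoint ip A B"
  shows "B (u + v) = B u + B v"
  using assms by (intro ip_left_cancel) (simp add: is_adjoint_def ip_add_left)

end

context incoming_modes
begin

lemma create_is_adjoint:
  assumes "c \<in> {a, b}" "f \<in> mode_functions"
  shows "is_adjoint ip (c (\<lambda>k. cnj (f k))) (create ip c f)"
proof -
  obtain B where "is_adjoint ip (c (\<lambda>k. cnj (f k))) B"
    using oper_adjoint[OF assms(1) mode_functions_cnj[OF assms(2)]] by blast
  then show ?thesis unfolding create_def using adj_eq by simp
qed

lemma annihilate_additive:
  assumes "c \<in> {a, b}" "f \<in> mode_functions"
  shows "c f (u + v) = c f u + c f v"
  using oper_linear[OF assms] by (simp add: Vector_Spaces.linear_iff)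

lemma create_additive:
  assumes "c \<in> {a, b}" "f \<in> mode_functions"
  shows "create ip c f (u + v) = create ip c f u + create ip c f v"
  using create_is_adjoint[OF assms] by (rule is_adjoint_additive)

text \<open>The adjoint conjugates coefficients and the test function was conjugated beforehand, so
  the result is linear in \<open>F\<close>. It is the field smeared with \<open>F\<close> with
  \<open>a\<close> and \<open>b\<close> exchanged, hence the field itself when they
  coincide.\<close>

lemma adj_deriv_field:
  assumes "coordinate X X1 X2" and F: "test_function F"
  shows "adj ip (deriv_field ip a b X (\<lambda>y. cnj (F y))) =
    (\<lambda>u. create ip a (\<lambda>k. coordinate.deriv_coeff X F (- k)) u + b (coordinate.deriv_coeff X F) u)"
proof -
  interpret coordinate X X1 X2 by fact
  let ?f = "\<lambda>k. cnj (deriv_coeff F (- k))" and ?g = "\<lambda>k. cnj (deriv_coeff F k)"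
  have mf: "deriv_coeff F \<in> mode_functions" "(\<lambda>k. deriv_coeff F (- k)) \<in> mode_functions"
    by (rule deriv_coeff_mode_functions[OF F])+
  have "deriv_field ip a b X (\<lambda>y. cnj (F y)) = (\<lambda>u. a ?f u + create ip b ?g u)"
  proof -
    have "mode_coeff X (\<lambda>y. - vector_derivative (\<lambda>y. cnj (F y)) (at y)) = ?f"
      using deriv_coeff_cnj[OF F] by (simp add: deriv_coeff_def fun_eq_iff)
    then show ?thesis by (simp add: deriv_field_def field_def)
  qed
  moreover have "is_adjoint ip (a ?f) (create ip a (\<lambda>k. deriv_coeff F (- k)))"
    using create_is_adjoint[of a, OF _ mf(2)] by simp
  moreover have "is_adjoint ip (create ip b ?g) (b (deriv_coeff F))"
    using create_is_adjoint[of b, OF _ mode_functions_cnj[OF mf(1)]] by (simp add: is_adjoint_sym)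
  ultimately show ?thesis
    using is_adjoint_add adj_eq by simp
qed

text \<open>Stated for an abstract functional so that vacuum and thermal state are both instances.
  One of the four products is out of normal order, and its commutator pairs \<open>b\<close> with
  itself; hence \<open>a = b\<close> and \<open>a \<noteq> b\<close> are treated alike.\<close>

lemma mean_of_product:
  fixes E :: "'h oper \<Rightarrow> complex" and \<nu> :: "real \<Rightarrow> real"
  assumes add: "\<And>A B. \<lbrakk>A \<in> field_algebra scale ip a b; B \<in> field_algebra scale ip a b\<rbrakk> \<Longrightarrow>
      E (\<lambda>u. A u + B u) = E A + E B"
    and scl: "\<And>A z. A \<in> field_algebra scale ip a b \<Longrightarrow> E (\<lambda>u. scale z (A u)) = z * E A"
    and one: "E id = 1"
    and ca: "\<And>c f g. \<lbrakk>c \<in> {a, b}; f \<in> mode_functions; g \<in> mode_functions\<rbrakk> \<Longrightarrow>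
      E (create ip c f \<circ> c g) = (LINT k:{0<..}|lborel. f k * g k * of_real (\<nu> k) / of_real (2 * k))"
    and aa: "\<And>c d f g. \<lbrakk>c \<in> {a, b}; d \<in> {a, b}; f \<in> mode_functions; g \<in> mode_functions\<rbrakk> \<Longrightarrow>
      E (c f \<circ> d g) = 0"
    and cc: "\<And>c d f g. \<lbrakk>c \<in> {a, b}; d \<in> {a, b}; f \<in> mode_functions; g \<in> mode_functions\<rbrakk> \<Longrightarrow>
      E (create ip c f \<circ> create ip d g) = 0"
    and co: "coordinate X X1 X2" and F: "test_function F" and G: "test_function G"
  defines "dF \<equiv> coordinate.deriv_coeff X F" and "dG \<equiv> coordinate.deriv_coeff X G"
  shows "E (adj ip (deriv_field ip a b X (\<lambda>y. cnj (F y))) \<circ> deriv_field ip a b X G) =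
     (LINT k:{0<..}|lborel. dF (- k) * dG k * of_real (\<nu> k) / of_real (2 * k))
     + ((LINT k:{0<..}|lborel. dF k * dG (- k) / of_real (2 * k))
     + (LINT k:{0<..}|lborel. dF k * dG (- k) * of_real (\<nu> k) / of_real (2 * k)))"
proof -
  interpret coordinate X X1 X2 by fact
  let ?R = "field_algebra scale ip a b"
  let ?dF' = "\<lambda>k. dF (- k)" and ?dG' = "\<lambda>k. dG (- k)"
  note mf = deriv_coeff_mode_functions[OF F, folded dF_def] deriv_coeff_mode_functions[OF G, folded dG_def]
  define P where "P = create ip a ?dF'"
  define Q where "Q = b dF"
  define R where "R = a dG"
  define S where "S = create ip b ?dG'"
  have PQ: "P (u + v) = P u + P v" "Q (u + v) = Q u + Q v" for u v
    unfolding P_def Q_def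
    using create_additive[of a ?dF' u v] annihilate_additive[of b dF u v] mf by simp_all
  have gens: "P \<in> ?R" "Q \<in> ?R" "R \<in> ?R" "S \<in> ?R"
    unfolding P_def Q_def R_def S_def
    by (rule field_algebra.gen, use mf in \<open>auto simp: mode_operators_def\<close>)+
  have prods: "P \<circ> R \<in> ?R" "P \<circ> S \<in> ?R" "Q \<circ> R \<in> ?R" "Q \<circ> S \<in> ?R" "S \<circ> Q \<in> ?R"
    by (intro field_algebra.mul gens)+
  define z where "z = (LINT k:{0<..}|lborel. dF k * ?dG' k / of_real (2 * k))"
  \<comment> \<open>The commutator is a multiple of the identity, so its mean is the same in every
    normalised state: the middle integral, free of \<nu>.\<close>
  have QS: "Q \<circ> S = (\<lambda>u. scale z (id u) + (S \<circ> Q) u)"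
  proof
    fix u
    have "Q (S u) - S (Q u) = scale z u"
      using commutator_create[of b b dF ?dG' u] mf by (simp add: Q_def S_def z_def)
    then show "(Q \<circ> S) u = scale z (id u) + (S \<circ> Q) u"
      by (simp add: diff_eq_eq)
  qed
  have QS1: "E (Q \<circ> S) = E (\<lambda>u. scale z (id u)) + E (S \<circ> Q)"
    unfolding QS by (rule add[OF field_algebra.scl[OF field_algebra.one] prods(5)])
  have QS2: "E (\<lambda>u. scale z (id u)) = z"
    using scl[OF field_algebra.one, of z] by (simp only: one mult_1_right)
  have QS3: "E (S \<circ> Q) = (LINT k:{0<..}|lborel. dF k * ?dG' k * of_real (\<nu> k) / of_real (2 * k))"
    unfolding S_def Q_def using ca[of b ?dG' dF] mf by (simp add: mult.commute)
  have PR: "E (P \<circ> R) = (LINT k:{0<..}|lborel. ?dF' k * dG k * of_real (\<nu> k) / of_real (2 * k))"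
    unfolding P_def R_def using ca[of a ?dF' dG] mf by simp
  have PS: "E (P \<circ> S) = 0" unfolding P_def S_def using cc[of a b ?dF' ?dG'] mf by simp
  have QR: "E (Q \<circ> R) = 0" unfolding Q_def R_def using aa[of b a dF dG] mf by simp
  have "adj ip (deriv_field ip a b X (\<lambda>y. cnj (F y))) = (\<lambda>u. P u + Q u)"
    unfolding P_def Q_def dF_def by (rule adj_deriv_field[OF co F])
  moreover have "deriv_field ip a b X G = (\<lambda>u. R u + S u)"
    by (simp add: R_def S_def dG_def deriv_field_def field_def deriv_coeff_def)
  ultimately have prod: "adj ip (deriv_field ip a b X (\<lambda>y. cnj (F y))) \<circ> deriv_field ip a b X G =
      (\<lambda>u. ((P \<circ> R) u + (P \<circ> S) u) + ((Q \<circ> R) u + (Q \<circ> S) u))"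
    by (simp add: fun_eq_iff PQ)
  have "E (\<lambda>u. ((P \<circ> R) u + (P \<circ> S) u) + ((Q \<circ> R) u + (Q \<circ> S) u)) =
      (E (P \<circ> R) + E (P \<circ> S)) + (E (Q \<circ> R) + E (Q \<circ> S))"
    using add[OF field_algebra.add[OF prods(1,2)] field_algebra.add[OF prods(3,4)]]
    unfolding add[OF prods(1,2)] add[OF prods(3,4)] .
  then show ?thesis
    unfolding prod PR PS QR QS1 QS2 QS3 by (simp only: add_0_right add_0_left z_def)
qed

text \<open>The instance with occupation number 0: an annihilator on the right kills the vacuum, and
  a creator moved to the left argument of the inner product becomes an annihilator that kills it
  there.\<close>

lemma vacuum_two_point:
  assumes "coordinate X X1 X2" "test_function F" "test_function G" "support F \<inter> support G = {}"
  shows "vacuum_mean ip \<Omega> (adj ip (deriv_field ip a b X (\<lambda>y. cnj (F y))) \<circ> deriv_field ip a b X G) =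
    (LINT p|lborel. F (fst p) * G (snd p) * coordinate.kernel X X1 (\<lambda>_. 0) (fst p) (snd p))"
proof -
  have c0: "c f 0 = 0" if "c \<in> {a, b}" "f \<in> mode_functions" for c f
    using annihilate_additive[OF that, of 0 0] by simp
  have d0: "create ip c f 0 = 0" if "c \<in> {a, b}" "f \<in> mode_functions" for c f
    using create_additive[OF that, of 0 0] by simp
  have cr: "ip \<Omega> (create ip c f u) = 0" if "c \<in> {a, b}" "f \<in> mode_functions" for c f u
  proof -
    have "ip \<Omega> (create ip c f u) = ip (c (\<lambda>k. cnj (f k)) \<Omega>) u"
      using is_adjoint_sym[OF create_is_adjoint[OF that]] by (simp add: is_adjoint_def)
    then show ?thesis
      using vacuum_annihilated[OF that(1) mode_functions_cnj[OF that(2)]] ip_zero_left by simp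
  qed
  have "vacuum_mean ip \<Omega> (adj ip (deriv_field ip a b X (\<lambda>y. cnj (F y))) \<circ> deriv_field ip a b X G) =
     (LINT k:{0<..}|lborel. coordinate.deriv_coeff X F (- k) * coordinate.deriv_coeff X G k * of_real 0 / of_real (2 * k))
     + ((LINT k:{0<..}|lborel. coordinate.deriv_coeff X F k * coordinate.deriv_coeff X G (- k) / of_real (2 * k))
     + (LINT k:{0<..}|lborel. coordinate.deriv_coeff X F k * coordinate.deriv_coeff X G (- k) * of_real 0 / of_real (2 * k)))"
    by (rule mean_of_product[where \<nu> = "\<lambda>_. 0", OF _ _ _ _ _ _ assms(1-3)])
       (simp_all add: vacuum_mean_def ip_add_right ip_scale_right vacuum_unit cr c0 d0 vacuum_annihilated ip_zero_right)
  also have "\<dots> = (LINT p|lborel. F (fst p) * G (snd p) * coordinate.kernel X X1 (\<lambda>_. 0) (fst p) (snd p))"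
    using coordinate.mode_sum_eq_kernel[OF assms, of "\<lambda>_. 0"] by (simp add: set_integrable_def)
  finally show ?thesis .
qed

end

lemma (in thermal_state) thermal_two_point_kernel:
  assumes "\<beta> > 0"
    and "coordinate X X1 X2" "test_function F" "test_function G" "support F \<inter> support G = {}"
  shows "\<omega> (adj ip (deriv_field ip a b X (\<lambda>y. cnj (F y))) \<circ> deriv_field ip a b X G) =
    (LINT p|lborel. F (fst p) * G (snd p) *
      coordinate.kernel X X1 (\<lambda>k. 1 / (exp (\<beta> * k) - 1)) (fst p) (snd p))"
proof -
  let ?\<nu> = "\<lambda>k. 1 / (exp (\<beta> * k) - 1)"
  have "set_integrable lborel {0<..} (\<lambda>k. k * ?\<nu> k)"
    using bose_integrable[OF assms(1)] by simp
  note kernel = coordinate.mode_sum_eq_kernel[OF assms(2-5) this]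
  have ca: "\<omega> (create ip c f \<circ> c g) = (LINT k:{0<..}|lborel. f k * g k * of_real (?\<nu> k) / of_real (2 * k))"
    if "c \<in> {a, b}" "f \<in> mode_functions" "g \<in> mode_functions" for c f g
  proof -
    have "f k * g k * of_real (?\<nu> k) / of_real (2 * k) = f k * g k / of_real (2 * k * (exp (\<beta> * k) - 1))" for k
      by simp
    then show ?thesis using thermal_two_point[OF that(1) that] by (simp only: simp_thms if_True)
  qed
  have "\<omega> (adj ip (deriv_field ip a b X (\<lambda>y. cnj (F y))) \<circ> deriv_field ip a b X G) =
      (LINT k:{0<..}|lborel. coordinate.deriv_coeff X F (- k) * coordinate.deriv_coeff X G k * of_real (?\<nu> k) / of_real (2 * k))
      + ((LINT k:{0<..}|lborel. coordinate.deriv_coeff X F k * coordinate.deriv_coeff X G (- k) / of_real (2 * k))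
      + (LINT k:{0<..}|lborel. coordinate.deriv_coeff X F k * coordinate.deriv_coeff X G (- k) * of_real (?\<nu> k) / of_real (2 * k)))"
    by (rule mean_of_product[where \<nu> = ?\<nu> and E = \<omega>, OF _ _ _ _ _ _ assms(2-4)])
      (rule state_add state_scale state_one ca annihilate_two_point create_two_point; assumption?)+
  then show ?thesis unfolding kernel .
qed

section \<open>Closed forms of the vacuum and thermal kernels\<close>

context coordinate
begin

text \<open>Test functions of disjoint support have \<open>F y * G y = 0\<close>, so the two kernels
  need to agree off the diagonal only and the junk value of \<open>kernel\<close> on it does no
  harm.\<close>

lemma two_point_kernelI:
  assumes E: "\<And>F G. \<lbrakk>test_function F; test_function G; support F \<inter> support G = {}\<rbrakk> \<Longrightarrow>
      E (adj ip (deriv_field ip a b X (\<lambda>y. cnj (F y))) \<circ> deriv_field ip a b X G) =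
      (LINT p|lborel. F (fst p) * G (snd p) * kernel \<nu> (fst p) (snd p))"
    and W: "\<And>y y'. y \<noteq> y' \<Longrightarrow> kernel \<nu> y y' = W y y'"
    and "continuous_on {p. fst p \<noteq> snd p} (\<lambda>p. W (fst p) (snd p))"
  shows "two_point_kernel ip a b E X W"
proof -
  have eq: "F (fst p) * G (snd p) * kernel \<nu> (fst p) (snd p) = F (fst p) * G (snd p) * W (fst p) (snd p)"
    if "support F \<inter> support G = {}" for F G p
  proof (cases "fst p = snd p")
    case True
    have "x \<in> support H" if "H x \<noteq> 0" for H x
      using that closure_subset[of "{x. H x \<noteq> 0}"] by (auto simp: support_def)
    with True \<open>support F \<inter> support G = {}\<close> have "F (fst p) = 0 \<or> G (snd p) = 0"
      by (metis disjoint_iff)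
    then show ?thesis by auto
  next
    case False
    then show ?thesis by (simp only: W[OF False])
  qed
  show ?thesis unfolding two_point_kernel_def
  proof (intro conjI allI impI)
    show "continuous_on {p. fst p \<noteq> snd p} (\<lambda>p. W (fst p) (snd p))" by fact
    fix F G
    assume FG: "test_function F \<and> test_function G \<and> support F \<inter> support G = {}"
    then have "E (adj ip (deriv_field ip a b X (\<lambda>y. cnj (F y))) \<circ> deriv_field ip a b X G) =
        (LINT p|lborel. F (fst p) * G (snd p) * kernel \<nu> (fst p) (snd p))"
      using E by blast
    also have "\<dots> = (LINT p|lborel. F (fst p) * G (snd p) * W (fst p) (snd p))"
      using eq[of F G] FG by (simp only:)
    finally show "E (adj ip (deriv_field ip a b X (\<lambda>y. cnj (F y))) \<circ> deriv_field ip a b X G) =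
        (LINT p|lborel. F (fst p) * G (snd p) * W (fst p) (snd p))" .
  qed
qed

lemma kernel_vacuum: "kernel (\<lambda>_. 0) y y' = of_real (- X1 y * X1 y' / (4 * pi * (X y - X y')\<^sup>2))"
  by (simp add: kernel_def)

text \<open>The \<open>1 / d^2\<close> of the cosine transform cancels the vacuum term of
  \<open>kernel\<close>. What remains is periodic in \<open>d\<close> with imaginary period i
  \<beta>, as expected at inverse temperature \<beta>.\<close>

lemma kernel_thermal:
  assumes "\<beta> > 0" "y \<noteq> y'"
  shows "kernel (\<lambda>k. 1 / (exp (\<beta> * k) - 1)) y y' =
    of_real (- X1 y * X1 y' / (4 * pi) * (pi / \<beta>)\<^sup>2 / (sinh (pi * (X y - X y') / \<beta>))\<^sup>2)"
proof -
  have "X y - X y' \<noteq> 0" using assms(2) X_eq_iff[of y y'] by simp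
  note B = bose_cosine_transform[OF assms(1) this]
  have k: "k * (1 / (exp (\<beta> * k) - 1)) = k / (exp (\<beta> * k) - 1)" for k by simp
  show ?thesis unfolding kernel_def k B by simp
qed

end

section \<open>Removal of the point splitting\<close>

text \<open>\<open>X2\<close> is assumed differentiable at the single point \<open>y\<close> only,
  so the Taylor remainders are controlled by l'Hospital: \<open>s\<close> by the definition of that
  derivative, \<open>r\<close> in turn by \<open>s\<close>.\<close>

lemma schwarzian_limit:
  fixes X X1 X2 :: "real \<Rightarrow> real"
  assumes X: "\<And>u. (X has_real_derivative X1 u) (at u)"
    and X1: "\<And>u. (X1 has_real_derivative X2 u) (at u)"
    and X2: "(X2 has_real_derivative x3) (at y)"
    and nz: "X1 y \<noteq> 0"
  shows "((\<lambda>\<epsilon>. X1 y * X1 (y + \<epsilon>) / (X (y + \<epsilon>) - X y)\<^sup>2 - 1 / \<epsilon>\<^sup>2) \<longlongrightarrow>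
    (x3 / X1 y - 3 / 2 * (X2 y / X1 y)\<^sup>2) / 6) (at 0)"
proof -
  define A B where "A = X1 y" and "B = X2 y"
  define s where "s \<epsilon> = (X1 (y + \<epsilon>) - A - \<epsilon> * B) / \<epsilon>\<^sup>2" for \<epsilon>
  define r where "r \<epsilon> = (X (y + \<epsilon>) - X y - \<epsilon> * A - \<epsilon>\<^sup>2 * B / 2) / \<epsilon> ^ 3" for \<epsilon>
  have shift: "((\<lambda>\<epsilon>. h (y + \<epsilon>)) has_real_derivative h' (y + \<epsilon>)) (at \<epsilon>)"
    if "\<And>u. (h has_real_derivative h' u) (at u)" for h h' :: "real \<Rightarrow> real" and \<epsilon>
  proof -
    have "((\<lambda>\<epsilon>. y + \<epsilon>) has_real_derivative 1) (at \<epsilon>)" by (auto intro!: derivative_eq_intros)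
    from DERIV_chain2[where f = h, OF that this] show ?thesis by simp
  qed
  have cont: "((\<lambda>\<epsilon>. h (y + \<epsilon>)) \<longlongrightarrow> h y) (at 0)" if "isCont h y" for h :: "real \<Rightarrow> real"
    using that by (simp add: isCont_iff)
  have cX: "((\<lambda>\<epsilon>. X (y + \<epsilon>)) \<longlongrightarrow> X y) (at 0)" and cX1: "((\<lambda>\<epsilon>. X1 (y + \<epsilon>)) \<longlongrightarrow> A) (at 0)"
    using X X1 DERIV_isCont cont unfolding A_def by blast+
  have ev: "\<forall>\<^sub>F \<epsilon> in at (0::real). \<epsilon> \<noteq> 0" by (simp add: eventually_at_filter)
  have s: "(s \<longlongrightarrow> x3 / 2) (at 0)"
    unfolding s_def
  proof (rule lhopital)
    show "((\<lambda>\<epsilon>. X1 (y + \<epsilon>) - A - \<epsilon> * B) \<longlongrightarrow> 0) (at 0)"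
      by (rule tendsto_eq_intros cX1 refl)+ simp
    show "((\<lambda>\<epsilon>::real. \<epsilon>\<^sup>2) \<longlongrightarrow> 0) (at 0)" by (rule tendsto_eq_intros refl)+ simp
    show "\<forall>\<^sub>F \<epsilon> in at 0. ((\<lambda>\<epsilon>. X1 (y + \<epsilon>) - A - \<epsilon> * B) has_real_derivative X2 (y + \<epsilon>) - B) (at \<epsilon>)"
      using shift[OF X1] by (intro always_eventually allI) (auto intro!: derivative_eq_intros)
    show "\<forall>\<^sub>F \<epsilon> in at 0. ((\<lambda>\<epsilon>::real. \<epsilon>\<^sup>2) has_real_derivative 2 * \<epsilon>) (at \<epsilon>)"
      by (intro always_eventually allI) (auto intro!: derivative_eq_intros)
    have "((\<lambda>\<epsilon>. (X2 (y + \<epsilon>) - B) / \<epsilon> / 2) \<longlongrightarrow> x3 / 2) (at 0)"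
      using X2 by (intro tendsto_intros) (auto simp: DERIV_def B_def)
    then show "((\<lambda>\<epsilon>. (X2 (y + \<epsilon>) - B) / (2 * \<epsilon>)) \<longlongrightarrow> x3 / 2) (at 0)"
      by (simp add: mult.commute)
  qed (use ev in \<open>auto elim: eventually_mono\<close>)
  have r: "(r \<longlongrightarrow> x3 / 6) (at 0)"
    unfolding r_def
  proof (rule lhopital)
    show "((\<lambda>\<epsilon>. X (y + \<epsilon>) - X y - \<epsilon> * A - \<epsilon>\<^sup>2 * B / 2) \<longlongrightarrow> 0) (at 0)"
      by (rule tendsto_eq_intros cX refl)+ simp_all
    show "((\<lambda>\<epsilon>::real. \<epsilon> ^ 3) \<longlongrightarrow> 0) (at 0)" by (rule tendsto_eq_intros refl)+ simp
    show "\<forall>\<^sub>F \<epsilon> in at 0. ((\<lambda>\<epsilon>. X (y + \<epsilon>) - X y - \<epsilon> * A - \<epsilon>\<^sup>2 * B / 2)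
        has_real_derivative X1 (y + \<epsilon>) - A - \<epsilon> * B) (at \<epsilon>)"
      using shift[OF X] by (intro always_eventually allI) (auto intro!: derivative_eq_intros)
    show "\<forall>\<^sub>F \<epsilon> in at 0. ((\<lambda>\<epsilon>::real. \<epsilon> ^ 3) has_real_derivative 3 * \<epsilon>\<^sup>2) (at \<epsilon>)"
      by (intro always_eventually allI) (auto intro!: derivative_eq_intros)
    have "((\<lambda>\<epsilon>. s \<epsilon> / 3) \<longlongrightarrow> x3 / 2 / 3) (at 0)"
      by (intro tendsto_intros s) simp
    then show "((\<lambda>\<epsilon>. (X1 (y + \<epsilon>) - A - \<epsilon> * B) / (3 * \<epsilon>\<^sup>2)) \<longlongrightarrow> x3 / 6) (at 0)"
      by (simp add: s_def mult.commute)
  qed (use ev in \<open>auto elim: eventually_mono\<close>)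
  \<comment> \<open>\<open>\<epsilon> * D \<epsilon>\<close> is the increment of \<open>X\<close>,
    and \<open>N\<close> is chosen such that \<open>A * X1 (y + \<epsilon>) = \<epsilon>\<^sup>2 * N
    \<epsilon> + (D \<epsilon>)\<^sup>2\<close>. After division by the squared increment the last
    summand is exactly the pole that is subtracted.\<close>
  define D where "D \<epsilon> = A + \<epsilon> * B / 2 + \<epsilon>\<^sup>2 * r \<epsilon>" for \<epsilon>
  define N where "N \<epsilon> = A * s \<epsilon> - B\<^sup>2 / 4 - 2 * A * r \<epsilon> - \<epsilon> * B * r \<epsilon> - \<epsilon>\<^sup>2 * (r \<epsilon>)\<^sup>2" for \<epsilon>
  have D: "(D \<longlongrightarrow> A) (at 0)"
  proof -
    have "(D \<longlongrightarrow> A + 0 * B / 2 + 0\<^sup>2 * (x3 / 6)) (at 0)"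
      unfolding D_def by (intro tendsto_intros r) simp_all
    then show ?thesis by simp
  qed
  have N: "(N \<longlongrightarrow> A * (x3 / 2) - B\<^sup>2 / 4 - 2 * A * (x3 / 6)) (at 0)"
  proof -
    have "(N \<longlongrightarrow> A * (x3 / 2) - B\<^sup>2 / 4 - 2 * A * (x3 / 6) - 0 * B * (x3 / 6) - 0\<^sup>2 * (x3 / 6)\<^sup>2) (at 0)"
      unfolding N_def by (intro tendsto_intros r s) simp_all
    then show ?thesis by simp
  qed
  have A: "A \<noteq> 0" using nz by (simp add: A_def)
  have "((\<lambda>\<epsilon>. N \<epsilon> / (D \<epsilon>)\<^sup>2) \<longlongrightarrow> (A * (x3 / 2) - B\<^sup>2 / 4 - 2 * A * (x3 / 6)) / A\<^sup>2) (at 0)"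
    using A by (intro tendsto_intros N D) simp
  moreover have "\<forall>\<^sub>F \<epsilon> in at 0. N \<epsilon> / (D \<epsilon>)\<^sup>2 =
      A * X1 (y + \<epsilon>) / (X (y + \<epsilon>) - X y)\<^sup>2 - 1 / \<epsilon>\<^sup>2"
    using ev tendsto_imp_eventually_ne[OF D A]
  proof eventually_elim
    case (elim \<epsilon>)
    have x1: "X1 (y + \<epsilon>) = A + \<epsilon> * B + \<epsilon>\<^sup>2 * s \<epsilon>" using elim(1) by (simp add: s_def)
    have d: "X (y + \<epsilon>) - X y = \<epsilon> * D \<epsilon>"
      using elim(1) by (simp add: D_def r_def field_simps power2_eq_square power3_eq_cube)
    have "A * (A + \<epsilon> * B + \<epsilon>\<^sup>2 * s \<epsilon>) = \<epsilon>\<^sup>2 * N \<epsilon> + (D \<epsilon>)\<^sup>2"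
      by (simp add: N_def D_def field_simps power2_eq_square)
    then have "A * X1 (y + \<epsilon>) / (X (y + \<epsilon>) - X y)\<^sup>2 = (\<epsilon>\<^sup>2 * N \<epsilon> + (D \<epsilon>)\<^sup>2) / (\<epsilon>\<^sup>2 * (D \<epsilon>)\<^sup>2)"
      by (simp only: x1 d power_mult_distrib)
    also have "\<dots> = N \<epsilon> / (D \<epsilon>)\<^sup>2 + 1 / \<epsilon>\<^sup>2"
      using elim by (simp add: add_divide_distrib)
    finally show ?case by simp
  qed
  ultimately have lim: "((\<lambda>\<epsilon>. A * X1 (y + \<epsilon>) / (X (y + \<epsilon>) - X y)\<^sup>2 - 1 / \<epsilon>\<^sup>2) \<longlongrightarrow>
      (A * (x3 / 2) - B\<^sup>2 / 4 - 2 * A * (x3 / 6)) / A\<^sup>2) (at 0)"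
    by (rule Lim_transform_eventually)
  have eq: "(A * (x3 / 2) - B\<^sup>2 / 4 - 2 * A * (x3 / 6)) / A\<^sup>2 = (x3 / A - 3 / 2 * (B / A)\<^sup>2) / 6"
    using A by (simp add: field_simps power2_eq_square)
  show ?thesis using lim unfolding eq unfolding A_def B_def .
qed

text \<open>The constant term of the Laurent expansion. It is the source of the thermal energy:
  \<open>(pi / \<beta>)^2 / 3 / (4 * pi) = pi / (12 * \<beta>^2)\<close>.\<close>

lemma csch_square_limit: "((\<lambda>z::real. 1 / (sinh z)\<^sup>2 - 1 / z\<^sup>2) \<longlongrightarrow> - 1 / 3) (at 0)"
  by real_asymp

context coordinate
begin

text \<open>Inserting the pole in the increment of \<open>X\<close> separates a part that depends on
  temperature, governed by \<open>csch_square_limit\<close>, from one that does not, governed by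
  \<open>schwarzian_limit\<close>.\<close>

lemma point_split_limit:
  fixes c :: real
  assumes X2': "(X2 has_real_derivative x3) (at y)" and c: "c > 0"
  shows "((\<lambda>\<epsilon>. X1 y * X1 (y + \<epsilon>) * c\<^sup>2 / (sinh (c * (X (y + \<epsilon>) - X y)))\<^sup>2 - 1 / \<epsilon>\<^sup>2) \<longlongrightarrow>
    (x3 / X1 y - 3 / 2 * (X2 y / X1 y)\<^sup>2) / 6 - c\<^sup>2 * (X1 y)\<^sup>2 / 3) (at 0)"
proof -
  let ?d = "\<lambda>\<epsilon>. X (y + \<epsilon>) - X y"
  have "((\<lambda>\<epsilon>. X (y + \<epsilon>)) \<longlongrightarrow> X y) (at 0)" and cX1: "((\<lambda>\<epsilon>. X1 (y + \<epsilon>)) \<longlongrightarrow> X1 y) (at 0)"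
    using DERIV_isCont[OF X[of y]] DERIV_isCont[OF X1[of y]] by (auto simp: isCont_iff)
  then have "((\<lambda>\<epsilon>. c * ?d \<epsilon>) \<longlongrightarrow> c * (X y - X y)) (at 0)" by (intro tendsto_intros)
  moreover have nz: "c * ?d \<epsilon> \<noteq> 0" if "\<epsilon> \<noteq> 0" for \<epsilon>
    using c that by (simp add: X_eq_iff)
  ultimately have "filterlim (\<lambda>\<epsilon>. c * ?d \<epsilon>) (at 0) (at 0)"
    by (simp add: filterlim_at eventually_at_filter)
  from filterlim_compose[OF csch_square_limit this]
  have "((\<lambda>\<epsilon>. X1 y * X1 (y + \<epsilon>) * c\<^sup>2 * (1 / (sinh (c * ?d \<epsilon>))\<^sup>2 - 1 / (c * ?d \<epsilon>)\<^sup>2) +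
      (X1 y * X1 (y + \<epsilon>) / (?d \<epsilon>)\<^sup>2 - 1 / \<epsilon>\<^sup>2)) \<longlongrightarrow>
      X1 y * X1 y * c\<^sup>2 * (- 1 / 3) + (x3 / X1 y - 3 / 2 * (X2 y / X1 y)\<^sup>2) / 6) (at 0)"
    using X1_pos[of y] by (intro tendsto_intros cX1 schwarzian_limit X X1 X2') auto
  then show ?thesis
  proof (rule Lim_transform_eventually[THEN tendsto_eq_rhs])
    \<comment> \<open>Valid for \<open>d = 0\<close> too, both quotients by a zero square then being
      0, so the identity holds for every \<epsilon>.\<close>
    have "p * c\<^sup>2 * (t - 1 / (c * d)\<^sup>2) = p * c\<^sup>2 * t - p / d\<^sup>2" for p t d
      using c by (simp add: right_diff_distrib power_mult_distrib)
    then show "\<forall>\<^sub>F \<epsilon> in at 0. X1 y * X1 (y + \<epsilon>) * c\<^sup>2 * (1 / (sinh (c * ?d \<epsilon>))\<^sup>2 - 1 / (c * ?d \<epsilon>)\<^sup>2) +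
      (X1 y * X1 (y + \<epsilon>) / (?d \<epsilon>)\<^sup>2 - 1 / \<epsilon>\<^sup>2) =
      X1 y * X1 (y + \<epsilon>) * c\<^sup>2 / (sinh (c * (X (y + \<epsilon>) - X y)))\<^sup>2 - 1 / \<epsilon>\<^sup>2"
      by (simp only:) simp
  qed (simp add: power2_eq_square)
qed

end

lemma coordinate_id: "coordinate (\<lambda>x. x) (\<lambda>_. 1) (\<lambda>_. 0)"
  by unfold_locales auto

text \<open>The incoming vacuum is handled by the identity coordinate. Its kernel depends on the
  difference of the points alone, so at \<open>X y\<close> and \<open>X y + \<epsilon>\<close> it
  contributes the plain pole in \<epsilon>.\<close>

lemma (in thermal_state) outgoing_emt_eq:
  assumes \<beta>: "\<beta> > 0" and co: "coordinate X X1 X2"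
    and X3: "\<And>y. (X2 has_real_derivative X3 y) (at y)"
  shows "outgoing_emt_exists ip \<Omega> a b \<omega> X"
    and "outgoing_emt ip \<Omega> a b \<omega> X y =
      of_real (pi / (12 * \<beta>\<^sup>2) * (X1 y)\<^sup>2 - (X3 y / X1 y - 3 / 2 * (X2 y / X1 y)\<^sup>2) / (24 * pi))"
proof -
  interpret coordinate X X1 X2 by fact
  interpret vac: coordinate "\<lambda>x. x" "\<lambda>_. 1" "\<lambda>_. 0" by (rule coordinate_id)
  define W where "W y y' = complex_of_real (- X1 y * X1 y' / (4 * pi) * (pi / \<beta>)\<^sup>2 /
      (sinh (pi * (X y - X y') / \<beta>))\<^sup>2)" for y y'
  define V where "V y y' = complex_of_real (- 1 * 1 / (4 * pi * (y - y')\<^sup>2))" for y y' :: real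
  have W: "two_point_kernel ip a b \<omega> X W"
  proof (rule two_point_kernelI[OF thermal_two_point_kernel[OF \<beta> co]])
    show "kernel (\<lambda>k. 1 / (exp (\<beta> * k) - 1)) y y' = W y y'" if "y \<noteq> y'" for y y'
      using kernel_thermal[OF \<beta> that] by (simp only: W_def)
    have "continuous_on A (\<lambda>p. X (fst p))" "continuous_on A (\<lambda>p. X (snd p))"
      "continuous_on A (\<lambda>p. X1 (fst p))" "continuous_on A (\<lambda>p. X1 (snd p))" for A :: "(real \<times> real) set"
      by (auto intro!: continuous_on_compose2[OF continuous_X] continuous_on_compose2[OF continuous_X1] continuous_intros)
    then show "continuous_on {p. fst p \<noteq> snd p} (\<lambda>p. W (fst p) (snd p))"
      unfolding W_def using \<beta> by (intro continuous_intros) (auto simp: X_eq_iff)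
  qed
  have V: "two_point_kernel ip a b (vacuum_mean ip \<Omega>) (\<lambda>x. x) V"
  proof (rule vac.two_point_kernelI[OF vacuum_two_point[OF coordinate_id]])
    show "vac.kernel (\<lambda>_. 0) y y' = V y y'" if "y \<noteq> y'" for y y'
      unfolding V_def by (rule vac.kernel_vacuum)
    show "continuous_on {p. fst p \<noteq> snd p} (\<lambda>p. V (fst p) (snd p))"
      unfolding V_def by (intro continuous_intros) auto
  qed
  define c where "c = pi / \<beta>"
  have c: "c > 0" using \<beta> by (simp add: c_def)
  \<comment> \<open>Restricted to nonzero \<epsilon>, where \<open>two_point\<close> is determined;
    the limit at 0 asks for no more. Both kernels are symmetric, so the two halves of
    \<open>mean_Theta\<close> agree.\<close>
  have split: "split_emt ip \<Omega> a b \<omega> X \<epsilon> y = of_real (- (X1 y * X1 (y + \<epsilon>) * c\<^sup>2 /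
      (sinh (c * (X (y + \<epsilon>) - X y)))\<^sup>2 - 1 / \<epsilon>\<^sup>2) / (4 * pi))" if "\<epsilon> \<noteq> 0" for \<epsilon> y
  proof -
    have "pi * (X y - X (y + \<epsilon>)) / \<beta> = - (c * (X (y + \<epsilon>) - X y))"
      "pi * (X (y + \<epsilon>) - X y) / \<beta> = c * (X (y + \<epsilon>) - X y)"
      by (simp_all add: c_def right_diff_distrib diff_divide_distrib)
    then have "W y (y + \<epsilon>) = of_real (- (X1 y * X1 (y + \<epsilon>) * c\<^sup>2 / (sinh (c * (X (y + \<epsilon>) - X y)))\<^sup>2) / (4 * pi))"
      "W (y + \<epsilon>) y = W y (y + \<epsilon>)"
      unfolding W_def c_def[symmetric] by (simp_all add: mult_ac)
    moreover have "V (X y) (X y + \<epsilon>) = of_real (- (1 / \<epsilon>\<^sup>2) / (4 * pi))" "V (X y + \<epsilon>) (X y) = V (X y) (X y + \<epsilon>)"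
      by (simp_all add: V_def)
    moreover have "two_point ip a b \<omega> X y (y + \<epsilon>) = W y (y + \<epsilon>)" "two_point ip a b \<omega> X (y + \<epsilon>) y = W (y + \<epsilon>) y"
      using that by (auto intro!: two_point_eq[OF W])
    moreover have "two_point ip a b (vacuum_mean ip \<Omega>) (\<lambda>x. x) (X y) (X y + \<epsilon>) = V (X y) (X y + \<epsilon>)"
      "two_point ip a b (vacuum_mean ip \<Omega>) (\<lambda>x. x) (X y + \<epsilon>) (X y) = V (X y + \<epsilon>) (X y)"
      using that by (auto intro!: two_point_eq[OF V])
    ultimately show ?thesis
      unfolding split_emt_def mean_Theta_def by (simp add: field_simps)
  qed
  have lim: "((\<lambda>\<epsilon>. split_emt ip \<Omega> a b \<omega> X \<epsilon> y) \<longlongrightarrow>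
      of_real (pi / (12 * \<beta>\<^sup>2) * (X1 y)\<^sup>2 - (X3 y / X1 y - 3 / 2 * (X2 y / X1 y)\<^sup>2) / (24 * pi))) (at 0)" for y
  proof -
    have "((\<lambda>\<epsilon>. complex_of_real (- (X1 y * X1 (y + \<epsilon>) * c\<^sup>2 / (sinh (c * (X (y + \<epsilon>) - X y)))\<^sup>2 - 1 / \<epsilon>\<^sup>2) / (4 * pi))) \<longlongrightarrow>
      of_real (- ((X3 y / X1 y - 3 / 2 * (X2 y / X1 y)\<^sup>2) / 6 - c\<^sup>2 * (X1 y)\<^sup>2 / 3) / (4 * pi))) (at 0)"
      by (intro tendsto_of_real tendsto_divide tendsto_minus point_split_limit X3 c tendsto_const) simp
    moreover have "- ((X3 y / X1 y - 3 / 2 * (X2 y / X1 y)\<^sup>2) / 6 - c\<^sup>2 * (X1 y)\<^sup>2 / 3) / (4 * pi) =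
      pi / (12 * \<beta>\<^sup>2) * (X1 y)\<^sup>2 - (X3 y / X1 y - 3 / 2 * (X2 y / X1 y)\<^sup>2) / (24 * pi)"
      using \<beta> by (simp add: c_def diff_divide_distrib power_divide power2_eq_square mult_ac)
    ultimately have "((\<lambda>\<epsilon>. complex_of_real (- (X1 y * X1 (y + \<epsilon>) * c\<^sup>2 / (sinh (c * (X (y + \<epsilon>) - X y)))\<^sup>2 - 1 / \<epsilon>\<^sup>2) / (4 * pi))) \<longlongrightarrow>
      of_real (pi / (12 * \<beta>\<^sup>2) * (X1 y)\<^sup>2 - (X3 y / X1 y - 3 / 2 * (X2 y / X1 y)\<^sup>2) / (24 * pi))) (at 0)"
      by (simp only:)
    then show ?thesis
      by (rule Lim_transform_eventually) (simp add: eventually_at_filter split)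
  qed
  show "outgoing_emt_exists ip \<Omega> a b \<omega> X"
    unfolding outgoing_emt_exists_def using W V lim by blast
  show "outgoing_emt ip \<Omega> a b \<omega> X y =
      of_real (pi / (12 * \<beta>\<^sup>2) * (X1 y)\<^sup>2 - (X3 y / X1 y - 3 / 2 * (X2 y / X1 y)\<^sup>2) / (24 * pi))"
    unfolding outgoing_emt_def by (rule tendsto_Lim[OF _ lim]) simp
qed

section \<open>The two black-hole models\<close>

lemma relativistic_black_hole_coordinate:
  "coordinate relativistic_black_hole (\<lambda>y. exp (- y)) (\<lambda>y. - exp (- y))"
  by unfold_locales
    (auto simp: relativistic_black_hole_def[abs_def] intro!: derivative_eq_intros continuous_intros)

lemma cghs_black_hole_coordinate:
  "coordinate cghs_black_hole (\<lambda>y. exp (- y) / (1 + exp (- y))) (\<lambda>y. - exp (- y) / (1 + exp (- y))\<^sup>2)"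
proof
  have pos: "1 + exp (- y) > 0" for y :: real by (simp add: add_pos_pos)
  have nz: "1 + exp (- y) \<noteq> 0" for y :: real using pos[of y] by simp
  show "(cghs_black_hole has_real_derivative exp (- y) / (1 + exp (- y))) (at y)" for y
    unfolding cghs_black_hole_def[abs_def] using pos[of y] by (auto intro!: derivative_eq_intros)
  show "((\<lambda>y. exp (- y) / (1 + exp (- y))) has_real_derivative - exp (- y) / (1 + exp (- y))\<^sup>2) (at y)" for y :: real
    using nz[of y] by (auto intro!: derivative_eq_intros simp: power2_eq_square algebra_simps)
  show "continuous_on UNIV (\<lambda>y::real. - exp (- y) / (1 + exp (- y))\<^sup>2)"
    using nz by (intro continuous_intros) auto
  show "exp (- y) / (1 + exp (- y)) > 0" for y :: real using pos[of y] by simp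
qed

theorem theorem19:
  fixes scale :: "complex \<Rightarrow> 'h::ab_group_add \<Rightarrow> 'h"
    and ip :: "'h \<Rightarrow> 'h \<Rightarrow> complex"
    and \<Omega> :: 'h
    and a b :: "'h modes"
    and \<beta> :: real
    and \<omega> :: "'h oper \<Rightarrow> complex"
  assumes "\<beta> > 0"
    and "thermal_state scale ip \<Omega> a b \<beta> \<omega>"
  shows "(\<forall>X \<in> {relativistic_black_hole, cghs_black_hole}.
            outgoing_emt_exists ip \<Omega> a b \<omega> X \<and>
            (outgoing_emt ip \<Omega> a b \<omega> X \<longlongrightarrow> of_real (thermal_emt_out (2 * pi))) at_top) \<and>
         (outgoing_emt ip \<Omega> a b \<omega> cghs_black_hole \<longlongrightarrow> of_real (thermal_emt_out \<beta>)) at_bot"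
proof -
  interpret thermal_state scale ip \<Omega> a b \<beta> \<omega> by fact
  have rel: "((\<lambda>y. - exp (- y)) has_real_derivative exp (- y)) (at y)" for y :: real
    by (auto intro!: derivative_eq_intros)
  note R = outgoing_emt_eq[OF assms(1) relativistic_black_hole_coordinate rel]
  have cghs: "((\<lambda>y. - exp (- y) / (1 + exp (- y))\<^sup>2) has_real_derivative
      exp (- y) * (1 - exp (- y)) / (1 + exp (- y)) ^ 3) (at y)" for y :: real
  proof -
    have "1 + exp (- y) > 0" by (simp add: add_pos_pos)
    then have nz: "1 + exp (- y) \<noteq> 0" by simp
    have "((\<lambda>y. - exp (- y) / (1 + exp (- y))\<^sup>2) has_real_derivative
        - ((2 * exp (- y) * exp (- y) * (1 + exp (- y)) - exp (- y) * (1 + exp (- y))\<^sup>2) / ((1 + exp (- y))\<^sup>2 * (1 + exp (- y))\<^sup>2))) (at y)"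
      using nz by (auto intro!: derivative_eq_intros simp: algebra_simps)
    \<comment> \<open>With \<open>q = 1 + exp (- y)\<close> the simplification becomes an identity
      of rational functions.\<close>
    moreover have "- ((2 * (q - 1) * (q - 1) * q - (q - 1) * q\<^sup>2) / (q\<^sup>2 * q\<^sup>2)) = (q - 1) * (2 - q) / q ^ 3"
      if "q \<noteq> 0" for q :: real
      using that by (simp add: divide_simps) (simp add: algebra_simps power2_eq_square power3_eq_cube power4_eq_xxxx)
    from this[OF nz] have "- ((2 * exp (- y) * exp (- y) * (1 + exp (- y)) - exp (- y) * (1 + exp (- y))\<^sup>2) / ((1 + exp (- y))\<^sup>2 * (1 + exp (- y))\<^sup>2)) =
        exp (- y) * (1 - exp (- y)) / (1 + exp (- y)) ^ 3"
      by simp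
    ultimately show ?thesis by (simp only:)
  qed
  note C = outgoing_emt_eq[OF assms(1) cghs_black_hole_coordinate cghs]
  have out: "thermal_emt_out (2 * pi) = 1 / (48 * pi)"
    by (simp add: thermal_emt_out_def power2_eq_square)
  \<comment> \<open>Here the Schwarzian derivative is -1/2 for every \<open>y\<close>, so the flux
    \<open>1 / (48 * pi)\<close> is present throughout and only the thermal term, proportional to
    \<open>exp (- 2 * y)\<close>, has to die out.\<close>
  have R_lim: "(outgoing_emt ip \<Omega> a b \<omega> relativistic_black_hole \<longlongrightarrow> of_real (1 / (48 * pi))) at_top"
    unfolding R(2) using assms(1) by (intro tendsto_of_real, real_asymp) (simp add: field_simps)
  \<comment> \<open>In terms of \<open>q = 1 + exp (- y)\<close> the Schwarzian derivative is
    \<open>(1 / 2 - q) / q^2\<close> and the first derivative is \<open>1 - 1 / q\<close>. Late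
    times correspond to \<open>q\<close> tending to 1, early times to \<open>q\<close> tending to
    infinity.\<close>
  have C_top: "(outgoing_emt ip \<Omega> a b \<omega> cghs_black_hole \<longlongrightarrow> of_real (1 / (48 * pi))) at_top"
    unfolding C(2) using assms(1) by (intro tendsto_of_real, real_asymp) (simp add: field_simps)
  have C_bot: "(outgoing_emt ip \<Omega> a b \<omega> cghs_black_hole \<longlongrightarrow> of_real (thermal_emt_out \<beta>)) at_bot"
    unfolding C(2) thermal_emt_out_def using assms(1) by (intro tendsto_of_real) real_asymp
  show ?thesis
    using R(1) C(1) R_lim C_top C_bot by (auto simp: out)
qed

end
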